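(* For $n\ge 0$ and a simplicial group $X$, the simplicial groups $$\Pi^{n\geq}_{\geq n+2}(X)=\frac{\mu_{n\geq}(X)}{\mu_{\geq n+2}(X)},\quad \Pi^{n\geq}_{n+1\geq}(X)=\frac{\mu_{n\geq}(X)}{\mu_{n+1\geq}(X)},\quad \Pi^{\geq n+1}_{\geq n+2}(X)=\frac{\mu_{\geq n+1}(X)}{\mu_{\geq n+2}(X)},\quad \Pi^{\geq n+1}_{n+1\geq}(X)=\frac{\mu_{\geq n+1}(X)}{\mu_{n+1\geq}(X)}$$ are $K(\pi_{n+1}(X),n+1)$-simplicial groups. Moreover, $\Pi^{\geq n+1}_{n+1\geq}(X)$ is isomorphic to $K(\pi_{n+1}(X),n+1)$, the $(n+1)$-th Eilenberg-Mac Lane simplicial group of $\pi_{n+1}(X)$.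
   Context: $Simp(Grp)$ is the category of simplicial groups, with face maps $d_i$. The Moore complex $N(X)$ is $N(X)_0=X_0$, $N(X)_k=\bigcap_{i=0}^{k-1}\ker(d_i:X_k\to X_{k-1})$ for $k\ge1$, with differential $\delta_k$ the restriction of $d_k$; $\pi_i(X)=H_i(N(X))$. For $n\ge 0$, $\mathcal{M}_{n\geq}$ is the full subcategory of simplicial groups with $N(X)_i=0$ for $i>n$, and $Cot_n$ is the left adjoint of the inclusion $\mathcal{M}_{n\geq}\to Simp(Grp)$ (it exists, its unit is a regular epimorphism, and $N(Cot_n(X))$ is $N(X)$ with $N(X)_n$ replaced by $N(X)_n/\delta_{n+1}(N(X)_{n+1})$ and $N(X)_i$ by $0$ for $i>n$). Set $\mu_{n\geq}(X)=\ker(X\to Cot_n(X))$. For $n\ge 1$, set $\mu_{\geq n}(X)=\ker(X\to cosk_{n-1}tr_{n-1}(X))$, the kernel of the unit of the adjunction $tr_{n-1}\dashv cosk_{n-1}$ between simplicial groups and $(n-1)$-truncated simplicial groups. As normal simplicial subgroups of $X$, $\dots\le\mu_{n+1\geq}(X)\le\mu_{\geq n+1}(X)\le\mu_{n\geq}(X)\le\mu_{\geq n}(X)\le\dots$. For an abelian group $A$, a $K(A,n)$-simplicial group is a simplicial group $Y$ with $\pi_n(Y)\cong A$ and all other homotopy groups trivial. For $n\ge1$, the $n$-th Eilenberg-Mac Lane simplicial group is $K(A,n)=cosk_{n+1}(k(A,n))$, where $k(A,n)$ is the $(n+1)$-truncated simplicial group that is $0$ in degrees $<n$, $A$ in degree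 $n$, $A^{n+1}$ in degree $n+1$, with faces $A^{n+1}\to A$ given by $(d_0,\dots,d_{n+1})=(p_0,p_0+p_1,p_1+p_2,\dots,p_{n-1}+p_n,p_n)$ ($p_0,\dots,p_n$ the product projections) and degeneracies $s_i:A\to A^{n+1}$, $0\le i\le n$, the inclusion in the $i$-th place. Its Moore complex is $A$ in degree $n$ and $0$ elsewhere. *)

theory Defs
  imports "HOL-Algebra.Product_Groups"
begin

section \<open>Simplicial groups\<close>

text \<open>
  All levels of a simplicial group share one element type; the operators therefore carry the level
  of their source: \<open>face X k i\<close> is $d_i : X_k \to X_{k-1}$ (for $k \ge 1$, $i \le k$) and
  \<open>degen X k i\<close> is $s_i : X_k \to X_{k+1}$ (for $i \le k$).  The same record carries truncated
  simplicial groups, in which case only the data up to the truncation level are meaningful.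
\<close>

record 'a sgrp =
  level :: "nat \<Rightarrow> 'a monoid"
  face  :: "nat \<Rightarrow> nat \<Rightarrow> 'a \<Rightarrow> 'a"
  degen :: "nat \<Rightarrow> nat \<Rightarrow> 'a \<Rightarrow> 'a"

locale simplicial_group =
  fixes X :: "'a sgrp"
  assumes group_level: "group (level X k)"
    and face_hom: "i \<le> Suc k \<Longrightarrow> face X (Suc k) i \<in> hom (level X (Suc k)) (level X k)"
    and degen_hom: "i \<le> k \<Longrightarrow> degen X k i \<in> hom (level X k) (level X (Suc k))"
    and face_face: "\<lbrakk>i < j; j \<le> Suc (Suc k); x \<in> carrier (level X (Suc (Suc k)))\<rbrakk> \<Longrightarrow>
      face X (Suc k) i (face X (Suc (Suc k)) j x) =
      face X (Suc k) (j - 1) (face X (Suc (Suc k)) i x)"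
    and degen_degen: "\<lbrakk>i \<le> j; j \<le> k; x \<in> carrier (level X k)\<rbrakk> \<Longrightarrow>
      degen X (Suc k) i (degen X k j x) = degen X (Suc k) (Suc j) (degen X k i x)"
    and face_degen_less: "\<lbrakk>i < j; j \<le> Suc k; x \<in> carrier (level X (Suc k))\<rbrakk> \<Longrightarrow>
      face X (Suc (Suc k)) i (degen X (Suc k) j x) = degen X k (j - 1) (face X (Suc k) i x)"
    and face_degen_same: "\<lbrakk>j \<le> k; x \<in> carrier (level X k)\<rbrakk> \<Longrightarrow>
      face X (Suc k) j (degen X k j x) = x"
    and face_degen_Suc: "\<lbrakk>j \<le> k; x \<in> carrier (level X k)\<rbrakk> \<Longrightarrow>
      face X (Suc k) (Suc j) (degen X k j x) = x"
    and face_degen_greater: "\<lbrakk>Suc j < i; i \<le> Suc (Suc k); x \<in> carrier (level X (Suc k))\<rbrakk> \<Longrightarrow>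
      face X (Suc (Suc k)) i (degen X (Suc k) j x) = degen X k j (face X (Suc k) (i - 1) x)"

definition simplicial_hom :: "'a sgrp \<Rightarrow> 'b sgrp \<Rightarrow> (nat \<Rightarrow> 'a \<Rightarrow> 'b) \<Rightarrow> bool" where
  "simplicial_hom X Y f \<longleftrightarrow>
     (\<forall>k. f k \<in> hom (level X k) (level Y k)) \<and>
     (\<forall>k. \<forall>i\<le>Suc k. \<forall>x\<in>carrier (level X (Suc k)).
        f k (face X (Suc k) i x) = face Y (Suc k) i (f (Suc k) x)) \<and>
     (\<forall>k. \<forall>i\<le>k. \<forall>x\<in>carrier (level X k).
        f (Suc k) (degen X k i x) = degen Y k i (f k x))"

definition simplicial_iso :: "'a sgrp \<Rightarrow> 'b sgrp \<Rightarrow> bool" where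
  "simplicial_iso X Y \<longleftrightarrow>
     (\<exists>f. simplicial_hom X Y f \<and> (\<forall>k. f k \<in> iso (level X k) (level Y k)))"

text \<open>
  The quotient $K/H$ for normal simplicial subgroups $H \le K$ of $X$.  The set-theoretic image of a
  coset of $H$ under an operator is in general only contained in a coset of $H$; multiplying by $H$
  yields that coset.
\<close>

definition subquotient :: "'a sgrp \<Rightarrow> (nat \<Rightarrow> 'a set) \<Rightarrow> (nat \<Rightarrow> 'a set) \<Rightarrow> 'a set sgrp" where
  "subquotient X K H =
     \<lparr>level = (\<lambda>k. ((level X k)\<lparr>carrier := K k\<rparr>) Mod (H k)),
      face = (\<lambda>k i c. H (k - 1) <#>\<^bsub>level X (k - 1)\<^esub> (face X k i ` c)),
      degen = (\<lambda>k i c. H (Suc k) <#>\<^bsub>level X (Suc k)\<^esub> (degen X k i ` c))\<rparr>"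


section \<open>Moore complex and homotopy groups\<close>

definition moore :: "'a sgrp \<Rightarrow> nat \<Rightarrow> 'a set" where
  "moore X k = {x \<in> carrier (level X k). \<forall>i<k. face X k i x = \<one>\<^bsub>level X (k - 1)\<^esub>}"

definition moore_cycles :: "'a sgrp \<Rightarrow> nat \<Rightarrow> 'a set" where
  "moore_cycles X k = {x \<in> moore X k. k \<ge> 1 \<longrightarrow> face X k k x = \<one>\<^bsub>level X (k - 1)\<^esub>}"

definition moore_boundaries :: "'a sgrp \<Rightarrow> nat \<Rightarrow> 'a set" where
  "moore_boundaries X k = face X (Suc k) (Suc k) ` moore X (Suc k)"

definition homotopy_group :: "nat \<Rightarrow> 'a sgrp \<Rightarrow> 'a set monoid" where
  "homotopy_group k X = ((level X k)\<lparr>carrier := moore_cycles X k\<rparr>) Mod (moore_boundaries X k)"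

definition K_simplicial_group :: "('b, 'c) monoid_scheme \<Rightarrow> nat \<Rightarrow> 'a sgrp \<Rightarrow> bool" where
  "K_simplicial_group A n Y \<longleftrightarrow>
     comm_group A \<and> simplicial_group Y \<and> homotopy_group n Y \<cong> A \<and>
     (\<forall>i. i \<noteq> n \<longrightarrow> trivial_group (homotopy_group i Y))"


section \<open>The reflection \<open>Cot\<close>\<close>

definition moore_bounded :: "nat \<Rightarrow> 'a sgrp \<Rightarrow> bool" where
  "moore_bounded n X \<longleftrightarrow>
     simplicial_group X \<and> (\<forall>i>n. moore X i = {\<one>\<^bsub>level X i\<^esub>})"

text \<open>
  \<open>is_reflection n X C u\<close>: the morphism $u : X \to C$ is a universal arrow from $X$ to the inclusion
  of the simplicial groups whose Moore complex vanishes above degree $n$.  The test objects are all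
  such simplicial groups over the element type of $C$.
\<close>

definition is_reflection :: "nat \<Rightarrow> 'a sgrp \<Rightarrow> 'b sgrp \<Rightarrow> (nat \<Rightarrow> 'a \<Rightarrow> 'b) \<Rightarrow> bool" where
  "is_reflection n X C u \<longleftrightarrow>
     moore_bounded n C \<and> simplicial_hom X C u \<and>
     (\<forall>(Y :: 'b sgrp) f. moore_bounded n Y \<and> simplicial_hom X Y f \<longrightarrow>
        (\<exists>g. simplicial_hom C Y g \<and> (\<forall>k. \<forall>x\<in>carrier (level X k). g k (u k x) = f k x) \<and>
           (\<forall>g'. simplicial_hom C Y g' \<and> (\<forall>k. \<forall>x\<in>carrier (level X k). g' k (u k x) = f k x)
              \<longrightarrow> (\<forall>k. \<forall>c\<in>carrier (level C k). g' k c = g k c))))"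

text \<open>
  The element type of the reflection is fixed to \<^typ>\<open>'a set\<close>: every quotient of $X$ is carried by
  this type, and every morphism out of $X$ factors through such a quotient, so it is large enough
  both to contain the reflection and to test its universal property.
\<close>

definition Cot_with_unit :: "nat \<Rightarrow> 'a sgrp \<Rightarrow> 'a set sgrp \<times> (nat \<Rightarrow> 'a \<Rightarrow> 'a set)" where
  "Cot_with_unit n X = (SOME p. is_reflection n X (fst p) (snd p))"

definition Cot :: "nat \<Rightarrow> 'a sgrp \<Rightarrow> 'a set sgrp" where
  "Cot n X = fst (Cot_with_unit n X)"

definition Cot_unit :: "nat \<Rightarrow> 'a sgrp \<Rightarrow> nat \<Rightarrow> 'a \<Rightarrow> 'a set" where
  "Cot_unit n X = snd (Cot_with_unit n X)"

text \<open>$\mu_{n\ge}(X)$\<close>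

definition mu_Cot :: "nat \<Rightarrow> 'a sgrp \<Rightarrow> nat \<Rightarrow> 'a set" where
  "mu_Cot n X k = kernel (level X k) (level (Cot n X) k) (Cot_unit n X k)"


section \<open>Truncation and coskeleton\<close>

definition tr :: "nat \<Rightarrow> 'a sgrp \<Rightarrow> 'a sgrp" where
  "tr m X =
     \<lparr>level = (\<lambda>k. if k \<le> m then level X k else undefined),
      face = (\<lambda>k. if k \<le> m then face X k else undefined),
      degen = (\<lambda>k. if k < m then degen X k else undefined)\<rparr>"

text \<open>
  A monotone map $\theta : [r] \to [k]$ is encoded by the list of its values: a sorted list of
  length $r + 1$ with entries at most $k$.  \<open>delta i\<close> and \<open>sigma i\<close> are the coface and codegeneracy
  maps; precomposing $\theta$ with them deletes, respectively repeats, its \<open>i\<close>-th entry.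
\<close>

definition monotone_maps :: "nat \<Rightarrow> nat \<Rightarrow> nat list set" where
  "monotone_maps m k = {\<theta>. \<theta> \<noteq> [] \<and> length \<theta> \<le> Suc m \<and> sorted \<theta> \<and> set \<theta> \<subseteq> {..k}}"

definition delta :: "nat \<Rightarrow> nat \<Rightarrow> nat" where
  "delta i j = (if j < i then j else Suc j)"

definition sigma :: "nat \<Rightarrow> nat \<Rightarrow> nat" where
  "sigma i j = (if j \<le> i then j else j - 1)"

definition delete_at :: "nat \<Rightarrow> 'b list \<Rightarrow> 'b list" where
  "delete_at i \<theta> = take i \<theta> @ drop (Suc i) \<theta>"

definition repeat_at :: "nat \<Rightarrow> 'b list \<Rightarrow> 'b list" where
  "repeat_at i \<theta> = take (Suc i) \<theta> @ drop i \<theta>"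

text \<open>
  The right adjoint of \<open>tr m\<close>, as the pointwise right Kan extension: $\mathrm{cosk}_m(T)_k$ is the
  limit of $T_r$ over all $\theta : [r] \to [k]$ with $r \le m$, i.e. the group of families
  $(x_\theta)_\theta$, $x_\theta \in T_r$, with $d_i x_\theta = x_{\theta\delta^i}$ and
  $s_i x_\theta = x_{\theta\sigma^i}$.  An operator $\alpha$ acts by
  $(\alpha^* x)_\theta = x_{\alpha\theta}$.
\<close>

definition cosk_level :: "nat \<Rightarrow> 'a sgrp \<Rightarrow> nat \<Rightarrow> (nat list \<Rightarrow> 'a) monoid" where
  "cosk_level m T k =
     (product_group (monotone_maps m k) (\<lambda>\<theta>. level T (length \<theta> - 1)))
       \<lparr>carrier := {x \<in> (\<Pi>\<^sub>E \<theta>\<in>monotone_maps m k. carrier (level T (length \<theta> - 1))).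
          (\<forall>\<theta>\<in>monotone_maps m k. \<forall>i<length \<theta>. 2 \<le> length \<theta> \<longrightarrow>
              face T (length \<theta> - 1) i (x \<theta>) = x (delete_at i \<theta>)) \<and>
          (\<forall>\<theta>\<in>monotone_maps m k. \<forall>i<length \<theta>. length \<theta> \<le> m \<longrightarrow>
              degen T (length \<theta> - 1) i (x \<theta>) = x (repeat_at i \<theta>))}\<rparr>"

definition cosk :: "nat \<Rightarrow> 'a sgrp \<Rightarrow> (nat list \<Rightarrow> 'a) sgrp" where
  "cosk m T =
     \<lparr>level = cosk_level m T,
      face = (\<lambda>k i x. \<lambda>\<theta>\<in>monotone_maps m (k - 1). x (map (delta i) \<theta>)),
      degen = (\<lambda>k i x. \<lambda>\<theta>\<in>monotone_maps m (Suc k). x (map (sigma i) \<theta>))\<rparr>"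

text \<open>
  The operator $\theta^* : X_k \to X_r$ of a monotone $\theta : [r] \to [k]$.  Writing
  $\theta = \delta^{j_p} \cdots \delta^{j_1} \sigma^{i_1} \cdots \sigma^{i_q}$ with
  $j_p > \dots > j_1$ the values missed by $\theta$ and $i_1 < \dots < i_q$ the positions with
  $\theta(i) = \theta(i+1)$, one has
  $\theta^* = s_{i_q} \cdots s_{i_1} d_{j_1} \cdots d_{j_p}$.
\<close>

fun face_word :: "'a sgrp \<Rightarrow> nat \<Rightarrow> nat list \<Rightarrow> 'a \<Rightarrow> 'a" where
  "face_word X k [] x = x"
| "face_word X k (j # js) x = face_word X (k - 1) js (face X k j x)"

fun degen_word :: "'a sgrp \<Rightarrow> nat \<Rightarrow> nat list \<Rightarrow> 'a \<Rightarrow> 'a" where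
  "degen_word X k [] x = x"
| "degen_word X k (i # is) x = degen_word X (Suc k) is (degen X k i x)"

definition simplicial_operator :: "'a sgrp \<Rightarrow> nat \<Rightarrow> nat list \<Rightarrow> 'a \<Rightarrow> 'a" where
  "simplicial_operator X k \<theta> x =
     degen_word X (card (set \<theta>) - 1) (filter (\<lambda>i. \<theta> ! i = \<theta> ! Suc i) [0..<length \<theta> - 1])
       (face_word X k (rev (filter (\<lambda>j. j \<notin> set \<theta>) [0..<Suc k])) x)"

text \<open>The unit $X \to \mathrm{cosk}_m \mathrm{tr}_m X$, $x \mapsto (\theta^* x)_\theta$.\<close>

definition cosk_unit :: "nat \<Rightarrow> 'a sgrp \<Rightarrow> nat \<Rightarrow> 'a \<Rightarrow> (nat list \<Rightarrow> 'a)" where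
  "cosk_unit m X k x = (\<lambda>\<theta>\<in>monotone_maps m k. simplicial_operator X k \<theta> x)"

text \<open>$\mu_{\ge n}(X)$, for $n \ge 1$\<close>

definition mu_cosk :: "nat \<Rightarrow> 'a sgrp \<Rightarrow> nat \<Rightarrow> 'a set" where
  "mu_cosk n X k =
     kernel (level X k) (level (cosk (n - 1) (tr (n - 1) X)) k) (cosk_unit (n - 1) X k)"


section \<open>Eilenberg-Mac Lane simplicial groups\<close>

text \<open>
  The $(n+1)$-truncated simplicial group $k(A,n)$ for $n \ge 1$: in degree $i$ it is the power
  $A^{r}$ with $r =$ \<open>em_rank n i\<close>, so $A$ in degree $n$ appears as $A^1$.
\<close>

definition em_rank :: "nat \<Rightarrow> nat \<Rightarrow> nat" where
  "em_rank n i = (if i < n then 0 else if i = n then 1 else Suc n)"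

definition em_trunc :: "('b, 'c) monoid_scheme \<Rightarrow> nat \<Rightarrow> (nat \<Rightarrow> 'b) sgrp" where
  "em_trunc A n =
     \<lparr>level = (\<lambda>k. product_group {..<em_rank n k} (\<lambda>_. A)),
      face = (\<lambda>k i x. \<lambda>j\<in>{..<em_rank n (k - 1)}.
         if k = Suc n
         then (if i = 0 then x 0 else if i = Suc n then x n else x (i - 1) \<otimes>\<^bsub>A\<^esub> x i)
         else \<one>\<^bsub>A\<^esub>),
      degen = (\<lambda>k i x. \<lambda>j\<in>{..<em_rank n (Suc k)}.
         if k = n \<and> j = i then x 0 else \<one>\<^bsub>A\<^esub>)\<rparr>"

definition eilenberg_mac_lane ::
    "('b, 'c) monoid_scheme \<Rightarrow> nat \<Rightarrow> (nat list \<Rightarrow> nat \<Rightarrow> 'b) sgrp" where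
  "eilenberg_mac_lane A n = cosk (Suc n) (em_trunc A n)"

end

theory Submission
  imports Defs
begin

text \<open>
  Both kinds of subgroup are determined by one level: \<open>\<mu>\<close> of the reflection in degree \<open>n\<close> is the largest
  simplicial subgroup that is trivial below \<open>n\<close> and equal to the boundaries \<open>B_n\<close> in degree \<open>n\<close>, and
  \<open>\<mu>\<close> of the coskeleton in degree \<open>n + 1\<close> is the one with the cycles \<open>Z_(n+1)\<close> in degree \<open>n + 1\<close>.
  Since the Moore complex is exact, the Moore complexes of the quotients can be read off, and
  \<open>Z_(n+1) / B_(n+1)\<close> is the only homology that survives.

  The last quotient \<open>Q\<close> has Moore complex \<open>\<pi>_(n+1)\<close> concentrated in degree \<open>N = n + 1\<close>. An element of
  \<open>Q_k\<close> is then the same as a normalised \<open>N\<close>-cocycle of the \<open>k\<close>-simplex with values in \<open>\<pi>_N\<close>, by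
  restriction along the injections \<open>[N] \<rightarrow> [k]\<close>, and so is an element of the coskeleton of
  \<open>k(\<pi>_N, N)\<close>; injectivity is by induction on \<open>k\<close>, surjectivity uses horn fillers.
\<close>

section \<open>Moore complexes\<close>

text \<open>All four quotients come from two arguments: the smaller subgroup is the coskeletal
  extension of \<open>S\<close> in degree N = n + 1, with \<open>S\<close> trivial or equal to the
  boundaries, and the larger one is \<mu> of the reflection in degree n or of the coskeleton in
  degree N. This rests on \<open>cosk_ext_trivial\<close>: being trivial in degree m and coskeletal
  above is the same as having the cycles in degree m + 1. \<open>Cot\<close> is a choice among
  reflections; its kernel is found by comparison with one explicit quotient. The operators of
  monotone maps are words in normal form, which are awkward to compose. For cochains, identities are
  proved by peeling cofaces off an injective list one at a time, so that commutation with a single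
  face suffices and the identity map is the base case. No degeneracy words occur there, because a
  cochain is set to 1 on lists with a repetition. In degree N + 1 of k(A, N) the coordinates are not
  the faces: they solve d_i p = p_(i-1) p_i, hence are partial alternating products of the faces,
  and the one face left over gives the cocycle condition.\<close>

context simplicial_group
begin

sublocale lev: group "level X k" for k
  by (rule group_level)

lemma face_closed [simp]:
  "i \<le> Suc k \<Longrightarrow> x \<in> carrier (level X (Suc k)) \<Longrightarrow> face X (Suc k) i x \<in> carrier (level X k)"
  using face_hom by (auto simp: hom_def)

lemma face_mult [simp]:
  "i \<le> Suc k \<Longrightarrow> x \<in> carrier (level X (Suc k)) \<Longrightarrow> y \<in> carrier (level X (Suc k)) \<Longrightarrow>
   face X (Suc k) i (x \<otimes>\<^bsub>level X (Suc k)\<^esub> y) = face X (Suc k) i x \<otimes>\<^bsub>level X k\<^esub> face X (Suc k) i y"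
  using face_hom by (auto simp: hom_def)

lemma face_group_hom:
  "i \<le> Suc k \<Longrightarrow> group_hom (level X (Suc k)) (level X k) (face X (Suc k) i)"
  by (simp add: group_hom_def group_hom_axioms_def face_hom)

lemma face_one [simp]: "i \<le> Suc k \<Longrightarrow> face X (Suc k) i \<one>\<^bsub>level X (Suc k)\<^esub> = \<one>\<^bsub>level X k\<^esub>"
  using face_group_hom group_hom.hom_one by metis

lemma face_inv [simp]:
  "i \<le> Suc k \<Longrightarrow> x \<in> carrier (level X (Suc k)) \<Longrightarrow>
   face X (Suc k) i (inv\<^bsub>level X (Suc k)\<^esub> x) = inv\<^bsub>level X k\<^esub> (face X (Suc k) i x)"
  using face_group_hom group_hom.hom_inv by metis

lemma degen_closed [simp]:
  "i \<le> k \<Longrightarrow> x \<in> carrier (level X k) \<Longrightarrow> degen X k i x \<in> carrier (level X (Suc k))"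
  using degen_hom by (auto simp: hom_def)

lemma degen_mult [simp]:
  "i \<le> k \<Longrightarrow> x \<in> carrier (level X k) \<Longrightarrow> y \<in> carrier (level X k) \<Longrightarrow>
   degen X k i (x \<otimes>\<^bsub>level X k\<^esub> y) = degen X k i x \<otimes>\<^bsub>level X (Suc k)\<^esub> degen X k i y"
  using degen_hom by (auto simp: hom_def)

lemma degen_group_hom:
  "i \<le> k \<Longrightarrow> group_hom (level X k) (level X (Suc k)) (degen X k i)"
  by (simp add: group_hom_def group_hom_axioms_def degen_hom)

lemma degen_one [simp]: "i \<le> k \<Longrightarrow> degen X k i \<one>\<^bsub>level X k\<^esub> = \<one>\<^bsub>level X (Suc k)\<^esub>"
  using degen_group_hom group_hom.hom_one by metis

lemma degen_inv [simp]:
  "i \<le> k \<Longrightarrow> x \<in> carrier (level X k) \<Longrightarrow>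
   degen X k i (inv\<^bsub>level X k\<^esub> x) = inv\<^bsub>level X (Suc k)\<^esub> (degen X k i x)"
  using degen_group_hom group_hom.hom_inv by metis

declare face_degen_same [simp] face_degen_Suc [simp]

lemma moore_carrier: "x \<in> moore X k \<Longrightarrow> x \<in> carrier (level X k)"
  by (simp add: moore_def)

lemma moore_cycles_carrier: "x \<in> moore_cycles X k \<Longrightarrow> x \<in> carrier (level X k)"
  by (simp add: moore_def moore_cycles_def)

lemma mem_moore_Suc:
  "x \<in> moore X (Suc k) \<longleftrightarrow>
     x \<in> carrier (level X (Suc k)) \<and> (\<forall>i\<le>k. face X (Suc k) i x = \<one>\<^bsub>level X k\<^esub>)"
  by (auto simp: moore_def)

lemma mem_moore_cycles_Suc:
  "x \<in> moore_cycles X (Suc k) \<longleftrightarrow>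
     x \<in> carrier (level X (Suc k)) \<and> (\<forall>i\<le>Suc k. face X (Suc k) i x = \<one>\<^bsub>level X k\<^esub>)"
  by (auto simp: moore_cycles_def mem_moore_Suc elim: le_SucE)

lemma moore_0: "moore X 0 = carrier (level X 0)"
  by (simp add: moore_def)

lemma moore_cycles_0: "moore_cycles X 0 = carrier (level X 0)"
  by (simp add: moore_cycles_def moore_def)

lemma normal_moore: "moore X k \<lhd> level X k"
proof (cases k)
  case 0 then show ?thesis
    by (simp add: moore_0 lev.normal_inv_iff lev.subgroup_self)
next
  case (Suc j)
  show ?thesis unfolding Suc
    by (intro lev.normal_invI subgroup.intro) (auto simp: mem_moore_Suc)
qed

lemma normal_moore_cycles: "moore_cycles X k \<lhd> level X k"
proof (cases k)
  case 0 then show ?thesis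
    by (simp add: moore_cycles_0 lev.normal_inv_iff lev.subgroup_self)
next
  case (Suc j)
  show ?thesis unfolding Suc
    by (intro lev.normal_invI subgroup.intro) (auto simp: mem_moore_cycles_Suc)
qed

lemma moore_boundaries_subset: "moore_boundaries X k \<subseteq> moore_cycles X k"
proof
  fix x assume "x \<in> moore_boundaries X k"
  then obtain y where y: "y \<in> moore X (Suc k)" "x = face X (Suc k) (Suc k) y"
    by (auto simp: moore_boundaries_def)
  show "x \<in> moore_cycles X k"
  proof (cases k)
    case 0 then show ?thesis using y by (simp add: moore_cycles_0 mem_moore_Suc)
  next
    case (Suc j)
    have "face X (Suc j) i (face X (Suc (Suc j)) (Suc (Suc j)) y) = \<one>\<^bsub>level X j\<^esub>" if "i \<le> Suc j" for i
      using that y Suc by (simp add: face_face mem_moore_Suc)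
    then show ?thesis using y Suc by (auto simp: mem_moore_cycles_Suc mem_moore_Suc)
  qed
qed

text \<open>Conjugation by \<open>x\<close> lifts to conjugation by \<open>degen X k k x\<close>,
  whose last face is \<open>x\<close>; normality of the Moore complex keeps the lifted conjugate
  inside it.\<close>

lemma normal_moore_boundaries: "moore_boundaries X k \<lhd> level X k"
proof (intro lev.normal_invI)
  interpret d: group_hom "level X (Suc k)" "level X k" "face X (Suc k) (Suc k)"
    by (rule face_group_hom) simp
  show "subgroup (moore_boundaries X k) (level X k)"
    unfolding moore_boundaries_def
    by (rule d.subgroup_img_is_subgroup) (rule normal_imp_subgroup[OF normal_moore])
  fix x h assume x: "x \<in> carrier (level X k)" and "h \<in> moore_boundaries X k"
  then obtain y where y: "y \<in> moore X (Suc k)" "h = face X (Suc k) (Suc k) y"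
    by (auto simp: moore_boundaries_def)
  let ?s = "degen X k k x"
  let ?z = "?s \<otimes>\<^bsub>level X (Suc k)\<^esub> y \<otimes>\<^bsub>level X (Suc k)\<^esub> inv\<^bsub>level X (Suc k)\<^esub> ?s"
  have "?z \<in> moore X (Suc k)"
    using normal.inv_op_closed2[OF normal_moore, of ?s "Suc k" y] x y by simp
  moreover have "face X (Suc k) (Suc k) ?z = x \<otimes>\<^bsub>level X k\<^esub> h \<otimes>\<^bsub>level X k\<^esub> inv\<^bsub>level X k\<^esub> x"
    using x y by (simp add: mem_moore_Suc)
  ultimately show "x \<otimes>\<^bsub>level X k\<^esub> h \<otimes>\<^bsub>level X k\<^esub> inv\<^bsub>level X k\<^esub> x \<in> moore_boundaries X k"
    unfolding moore_boundaries_def by (metis image_eqI)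
qed

lemma homotopy_group_group: "group (homotopy_group k X)"
  unfolding homotopy_group_def
  by (intro normal.factorgroup_is_group lev.normal_restrict_supergroup normal_imp_subgroup
      normal_moore_cycles normal_moore_boundaries moore_boundaries_subset)

text \<open>The commutator of two elements killed by complementary sets of faces lies in the Moore
  complex: \<open>b\<close> is killed by the faces up to k and \<open>a\<close> by face k + 1. Its
  last face is the commutator of \<open>x\<close> and \<open>y\<close>.\<close>

lemma commutator_in_moore_boundaries:
  assumes x: "x \<in> moore_cycles X (Suc k)" and y: "y \<in> moore_cycles X (Suc k)"
  shows "x \<otimes>\<^bsub>level X (Suc k)\<^esub> y \<otimes>\<^bsub>level X (Suc k)\<^esub> inv\<^bsub>level X (Suc k)\<^esub> x \<otimes>\<^bsub>level X (Suc k)\<^esub> inv\<^bsub>level X (Suc k)\<^esub> y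
    \<in> moore_boundaries X (Suc k)"
proof -
  let ?G = "level X (Suc (Suc k))"
  have xy: "x \<in> carrier (level X (Suc k))" "y \<in> carrier (level X (Suc k))"
    using x y by (auto simp: mem_moore_cycles_Suc)
  \<comment> \<open>The factor with s_k cancels face k + 1 of s_(k+1) \<open>x\<close>, and it
    contributes nothing to face k + 2 because \<open>x\<close> is a cycle.\<close>
  define a where "a = inv\<^bsub>?G\<^esub> (degen X (Suc k) k x) \<otimes>\<^bsub>?G\<^esub> degen X (Suc k) (Suc k) x"
  define b where "b = degen X (Suc k) (Suc k) y"
  define w where "w = a \<otimes>\<^bsub>?G\<^esub> b \<otimes>\<^bsub>?G\<^esub> inv\<^bsub>?G\<^esub> a \<otimes>\<^bsub>?G\<^esub> inv\<^bsub>?G\<^esub> b"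
  have ab: "a \<in> carrier ?G" "b \<in> carrier ?G"
    using xy by (auto simp: a_def b_def)
  have s1: "face X (Suc (Suc k)) i (degen X (Suc k) (Suc k) z) = \<one>\<^bsub>level X (Suc k)\<^esub>"
    if "i \<le> k" "z \<in> moore_cycles X (Suc k)" for i z
    using that by (simp add: face_degen_less mem_moore_cycles_Suc)
  have s0: "face X (Suc (Suc k)) (Suc (Suc k)) (degen X (Suc k) k x) = \<one>\<^bsub>level X (Suc k)\<^esub>"
    using x by (simp add: face_degen_greater mem_moore_cycles_Suc)
  have "face X (Suc (Suc k)) i w = \<one>\<^bsub>level X (Suc k)\<^esub>" if i: "i \<le> Suc k" for i
  proof (cases "i = Suc k")
    case True
    then have "face X (Suc (Suc k)) i a = \<one>\<^bsub>level X (Suc k)\<^esub>"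
      using xy by (simp add: a_def)
    then show ?thesis using i ab by (simp add: w_def)
  next
    case False
    then have "face X (Suc (Suc k)) i b = \<one>\<^bsub>level X (Suc k)\<^esub>"
      using s1[of i y] y i by (simp add: b_def)
    then show ?thesis using i ab by (simp add: w_def)
  qed
  then have "w \<in> moore X (Suc (Suc k))"
    using ab by (simp add: mem_moore_Suc w_def)
  moreover have "face X (Suc (Suc k)) (Suc (Suc k)) a = x"
    using xy s0 by (simp add: a_def)
  then have "face X (Suc (Suc k)) (Suc (Suc k)) w =
    x \<otimes>\<^bsub>level X (Suc k)\<^esub> y \<otimes>\<^bsub>level X (Suc k)\<^esub> inv\<^bsub>level X (Suc k)\<^esub> x \<otimes>\<^bsub>level X (Suc k)\<^esub> inv\<^bsub>level X (Suc k)\<^esub> y"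
    using ab xy by (simp add: w_def b_def)
  ultimately show ?thesis
    unfolding moore_boundaries_def by (metis image_eqI)
qed

lemma homotopy_group_comm: "comm_group (homotopy_group (Suc k) X)"
proof -
  let ?G = "level X (Suc k)" and ?Z = "moore_cycles X (Suc k)" and ?B = "moore_boundaries X (Suc k)"
  interpret P: group "homotopy_group (Suc k) X"
    by (rule homotopy_group_group)
  interpret B: normal ?B ?G by (rule normal_moore_boundaries)
  show ?thesis
  proof (rule P.group_comm_groupI)
    fix c c' assume "c \<in> carrier (homotopy_group (Suc k) X)" "c' \<in> carrier (homotopy_group (Suc k) X)"
    then obtain x y where xy: "x \<in> ?Z" "y \<in> ?Z" and c: "c = ?B #>\<^bsub>?G\<^esub> x" "c' = ?B #>\<^bsub>?G\<^esub> y"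
      by (auto simp: homotopy_group_def FactGroup_def RCOSETS_def)
    have [simp]: "x \<in> carrier ?G" "y \<in> carrier ?G"
      using xy by (auto simp: mem_moore_cycles_Suc)
    have "(x \<otimes>\<^bsub>?G\<^esub> y) \<otimes>\<^bsub>?G\<^esub> inv\<^bsub>?G\<^esub> (y \<otimes>\<^bsub>?G\<^esub> x) \<in> ?B"
      using commutator_in_moore_boundaries[OF xy] by (simp add: lev.inv_mult_group lev.m_assoc)
    then have "x \<otimes>\<^bsub>?G\<^esub> y \<in> ?B #>\<^bsub>?G\<^esub> (y \<otimes>\<^bsub>?G\<^esub> x)"
      by (simp add: B.rcos_module_rev lev.is_group)
    then have "?B #>\<^bsub>?G\<^esub> (y \<otimes>\<^bsub>?G\<^esub> x) = ?B #>\<^bsub>?G\<^esub> (x \<otimes>\<^bsub>?G\<^esub> y)"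
      by (intro lev.repr_independence) (auto simp: B.subgroup_axioms)
    then show "c \<otimes>\<^bsub>homotopy_group (Suc k) X\<^esub> c' = c' \<otimes>\<^bsub>homotopy_group (Suc k) X\<^esub> c"
      by (simp add: c homotopy_group_def FactGroup_def B.rcos_sum)
  qed
qed

text \<open>Horn fillers are built one face at a time: the correction term at stage \<open>r\<close> is degenerate along
  \<open>s_r\<close>, which leaves the faces below \<open>r\<close> unchanged.\<close>

lemma horn_filler_upto:
  assumes y: "\<And>i. i \<le> k \<Longrightarrow> y i \<in> carrier (level X k)"
    and comp: "\<And>i j. i < j \<Longrightarrow> j \<le> k \<Longrightarrow> 0 < k \<Longrightarrow> face X k i (y j) = face X k (j - 1) (y i)"
    and S: "subgroup S (level X (Suc k))" "subgroup T (level X k)"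
      "\<And>i t. i \<le> k \<Longrightarrow> t \<in> T \<Longrightarrow> degen X k i t \<in> S"
      "\<And>i s. i \<le> k \<Longrightarrow> s \<in> S \<Longrightarrow> face X (Suc k) i s \<in> T"
      "\<And>i. i \<le> k \<Longrightarrow> y i \<in> T"
  shows "r \<le> Suc k \<Longrightarrow> \<exists>w\<in>S. \<forall>i<r. face X (Suc k) i w = y i"
proof (induction r)
  case 0
  then show ?case using subgroup.one_closed[OF S(1)] by auto
next
  case (Suc r)
  then obtain w where w: "w \<in> S" "\<forall>i<r. face X (Suc k) i w = y i"
    by auto
  have r: "r \<le> k" using Suc.prems by simp
  have wc: "w \<in> carrier (level X (Suc k))" using w S(1) subgroup.subset by blast
  let ?t = "inv\<^bsub>level X k\<^esub> (face X (Suc k) r w) \<otimes>\<^bsub>level X k\<^esub> y r"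
  let ?w = "w \<otimes>\<^bsub>level X (Suc k)\<^esub> degen X k r ?t"
  have tc: "?t \<in> carrier (level X k)" using wc r y by simp
  \<comment> \<open>The subgroups \<open>S\<close> and \<open>T\<close> are carried along so that a
    horn in a simplicial subgroup receives a filler in the same subgroup.\<close>
  have "?t \<in> T"
    using w r S by (meson subgroup.m_closed subgroup.m_inv_closed)
  then have "?w \<in> S" using w S r by (meson subgroup.m_closed)
  moreover have "face X (Suc k) i ?w = y i" if "i < Suc r" for i
  proof (cases "i = r")
    case True
    have "face X (Suc k) r ?w = face X (Suc k) r w \<otimes>\<^bsub>level X k\<^esub> ?t"
      using wc tc r by simp
    then show ?thesis using True wc y[OF r] r by (simp add: lev.m_assoc[symmetric])
  next
    case False
    then have i: "i < r" using that by simp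
    then obtain k' where k': "k = Suc k'" using r by (cases k) auto
    \<comment> \<open>Compatibility of the horn enters here: face r of \<open>w\<close> and
      \<open>y r\<close> have the same faces below r, so the correction term has none.\<close>
    have "face X (Suc k') i ?t = \<one>\<^bsub>level X k'\<^esub>"
    proof -
      have "face X (Suc k') i (face X (Suc k) r w) = face X (Suc k') (r - 1) (face X (Suc k) i w)"
        using face_face[of i r k' w] i r wc k' by simp
      also have "\<dots> = face X (Suc k') (r - 1) (y i)" using w i by simp
      also have "\<dots> = face X (Suc k') i (y r)" using comp[of i r] i r k' by simp
      finally show ?thesis using i r wc y[of r] k' by simp
    qed
    then have "face X (Suc k) i (degen X k r ?t) = \<one>\<^bsub>level X k\<^esub>"
      using face_degen_less[of i r k' ?t] i r tc k' by simp
    then show ?thesis using wc tc r i w y by simp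
  qed
  ultimately show ?case by blast
qed

end

locale normal_simplicial_subgroup = simplicial_group X for X :: "'a sgrp" +
  fixes H :: "nat \<Rightarrow> 'a set"
  assumes normal_level: "H k \<lhd> level X k"
    and face_in: "i \<le> Suc k \<Longrightarrow> h \<in> H (Suc k) \<Longrightarrow> face X (Suc k) i h \<in> H k"
    and degen_in: "i \<le> k \<Longrightarrow> h \<in> H k \<Longrightarrow> degen X k i h \<in> H (Suc k)"
begin

sublocale sub: normal "H k" "level X k" for k
  by (rule normal_level)

text \<open>The Moore complex functor is exact: an element whose faces but the last lie in \<open>H\<close> is congruent
  modulo \<open>H\<close> to an element of the Moore complex.\<close>

lemma moore_representative:
  assumes x: "x \<in> carrier (level X k)" and f: "\<And>i. i < k \<Longrightarrow> face X k i x \<in> H (k - 1)"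
  obtains h where "h \<in> H k" "h \<otimes>\<^bsub>level X k\<^esub> x \<in> moore X k"
proof (cases k)
  case 0
  then show ?thesis using that[of "\<one>\<^bsub>level X k\<^esub>"] x by (simp add: moore_0)
next
  case (Suc j)
  \<comment> \<open>The inverses of the faces of \<open>x\<close> below the last one form a horn in
    \<open>H\<close>; multiplying \<open>x\<close> by a filler cancels them all at once.\<close>
  have "\<exists>w\<in>H (Suc j). \<forall>i<Suc j. face X (Suc j) i w = inv\<^bsub>level X j\<^esub> face X (Suc j) i x"
  proof (rule horn_filler_upto[where T = "H j"])
    fix a b assume ab: "a < b" "b \<le> j" "0 < j"
    then obtain j' where j': "j = Suc j'" by (cases j) auto
    show "face X j a (inv\<^bsub>level X j\<^esub> face X (Suc j) b x) =
       face X j (b - 1) (inv\<^bsub>level X j\<^esub> face X (Suc j) a x)"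
      using ab x Suc face_face[of a b j' x] unfolding j' by simp
  qed (use x f Suc in \<open>auto simp: sub.subgroup_axioms face_in degen_in\<close>)
  then obtain w where w: "w \<in> H (Suc j)" "\<forall>i<Suc j. face X (Suc j) i w = inv\<^bsub>level X j\<^esub> face X (Suc j) i x"
    by blast
  then have "w \<otimes>\<^bsub>level X k\<^esub> x \<in> moore X k"
    using x Suc sub.mem_carrier by (auto simp: mem_moore_Suc)
  then show ?thesis using that w Suc by simp
qed

end

section \<open>Coskeletal extensions of a subgroup and subquotients\<close>

text \<open>The largest simplicial subset of \<open>X\<close> that is trivial below degree \<open>m\<close> and equals \<open>S\<close> in degree \<open>m\<close>.
  Each of the subgroups \<open>\<mu>\<close> has this form, with \<open>S\<close> the trivial group, the boundaries or the cycles.\<close>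

primrec cosk_ext :: "'a sgrp \<Rightarrow> nat \<Rightarrow> 'a set \<Rightarrow> nat \<Rightarrow> 'a set" where
  "cosk_ext X m S 0 = (if m = 0 then S else {\<one>\<^bsub>level X 0\<^esub>})"
| "cosk_ext X m S (Suc k) =
     (if Suc k < m then {\<one>\<^bsub>level X (Suc k)\<^esub>} else if Suc k = m then S
      else {x \<in> carrier (level X (Suc k)). \<forall>i\<le>Suc k. face X (Suc k) i x \<in> cosk_ext X m S k})"

lemma cosk_ext_less: "k < m \<Longrightarrow> cosk_ext X m S k = {\<one>\<^bsub>level X k\<^esub>}"
  by (cases k) auto

lemma cosk_ext_same [simp]: "cosk_ext X m S m = S"
  by (cases m) auto

lemma cosk_ext_Suc:
  "m \<le> k \<Longrightarrow> cosk_ext X m S (Suc k) =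
     {x \<in> carrier (level X (Suc k)). \<forall>i\<le>Suc k. face X (Suc k) i x \<in> cosk_ext X m S k}"
  by auto

declare cosk_ext.simps(2) [simp del]

context simplicial_group
begin

lemma normal_cosk_ext:
  assumes "S \<lhd> level X m" shows "cosk_ext X m S k \<lhd> level X k"
proof (induction k)
  case 0 then show ?case using assms by (cases "m = 0") (simp_all add: lev.one_is_normal)
next
  case (Suc k)
  consider "Suc k < m" | "Suc k = m" | "m \<le> k" by linarith
  then show ?case
  proof cases
    case 3
    interpret E: normal "cosk_ext X m S k" "level X k" by (rule Suc.IH)
    show ?thesis
      unfolding cosk_ext_Suc[OF 3] using E.inv_op_closed2
      by (intro lev.normal_invI subgroup.intro) auto
  qed (use assms in \<open>auto simp: cosk_ext_less lev.one_is_normal\<close>)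
qed

text \<open>The critical degree is m: the faces of an element of \<open>S\<close> must land in the
  trivial group below, which is why \<open>S\<close> has to consist of cycles.\<close>

lemma cosk_ext_face:
  assumes "S \<subseteq> moore_cycles X m" "i \<le> Suc k" "h \<in> cosk_ext X m S (Suc k)"
  shows "face X (Suc k) i h \<in> cosk_ext X m S k"
proof -
  consider "Suc k < m" | "Suc k = m" | "m \<le> k" by linarith
  then show ?thesis
  proof cases
    case 1 then show ?thesis using assms by (simp add: cosk_ext_less)
  next
    case 2 then show ?thesis using assms by (auto simp: cosk_ext_less mem_moore_cycles_Suc)
  next
    case 3 then show ?thesis using assms by (simp add: cosk_ext_Suc)
  qed
qed

text \<open>By the simplicial identities every face of \<open>degen X k j h\<close> is
  \<open>h\<close> itself or a degeneracy of a face of \<open>h\<close>, so the face condition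
  follows from the claim one degree lower.\<close>

lemma cosk_ext_degen:
  assumes S: "S \<lhd> level X m" "S \<subseteq> moore_cycles X m"
  shows "j \<le> k \<Longrightarrow> h \<in> cosk_ext X m S k \<Longrightarrow> degen X k j h \<in> cosk_ext X m S (Suc k)"
proof (induction k arbitrary: j h)
  case (0 j h)
  show ?case
  proof (cases "m = 0")
    case True
    have "i \<le> Suc 0 \<Longrightarrow> face X (Suc 0) i (degen X 0 0 h) = h" for i
      using 0 True S(2) moore_cycles_carrier by (cases i) auto
    then show ?thesis using 0 True S(2) moore_cycles_carrier by (auto simp: cosk_ext_Suc)
  next
    case False
    then have "h = \<one>\<^bsub>level X 0\<^esub>" using 0 by simp
    then have "degen X 0 j h = \<one>\<^bsub>level X (Suc 0)\<^esub>" using 0 by simp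
    then show ?thesis
      using normal_imp_subgroup[OF normal_cosk_ext[OF S(1)]] subgroup.one_closed by metis
  qed
next
  case (Suc k j h)
  have hc: "h \<in> carrier (level X (Suc k))"
    using normal_imp_subgroup[OF normal_cosk_ext[OF S(1)]] subgroup.subset Suc.prems by blast
  show ?case
  proof (cases "Suc k < m")
    case True
    then have "h = \<one>\<^bsub>level X (Suc k)\<^esub>" using Suc by (simp add: cosk_ext_less)
    then have "degen X (Suc k) j h = \<one>\<^bsub>level X (Suc (Suc k))\<^esub>" using Suc by simp
    then show ?thesis
      using normal_imp_subgroup[OF normal_cosk_ext[OF S(1)]] subgroup.one_closed by metis
  next
    case False
    have "face X (Suc (Suc k)) i (degen X (Suc k) j h) \<in> cosk_ext X m S (Suc k)"
      if i: "i \<le> Suc (Suc k)" for i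
    proof -
      consider "i < j" | "i = j \<or> i = Suc j" | "Suc j < i" by linarith
      then show ?thesis
      proof cases
        case 1
        then show ?thesis
          using Suc hc cosk_ext_face[OF S(2), of i k h] by (simp add: face_degen_less)
      next
        case 2 then show ?thesis using Suc hc by auto
      next
        case 3
        then show ?thesis
          using Suc hc i cosk_ext_face[OF S(2), of "i - 1" k h] by (simp add: face_degen_greater)
      qed
    qed
    then show ?thesis using False hc Suc.prems by (simp add: cosk_ext_Suc)
  qed
qed

lemma normal_simplicial_subgroup_cosk_ext:
  assumes "S \<lhd> level X m" "S \<subseteq> moore_cycles X m"
  shows "normal_simplicial_subgroup X (cosk_ext X m S)"
  using normal_cosk_ext cosk_ext_face cosk_ext_degen assms
  by (intro normal_simplicial_subgroup.intro normal_simplicial_subgroup_axioms.intro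
      simplicial_group_axioms) auto

lemma normal_simplicial_subgroup_carrier:
  "normal_simplicial_subgroup X (\<lambda>k. carrier (level X k))"
  by (intro normal_simplicial_subgroup.intro normal_simplicial_subgroup_axioms.intro
      simplicial_group_axioms) (simp_all add: lev.normal_inv_iff lev.subgroup_self)

lemma cosk_ext_mono:
  assumes T: "S \<subseteq> T"
  shows "cosk_ext X m S k \<subseteq> cosk_ext X m T k"
  by (induction k) (use T in \<open>auto simp: cosk_ext.simps(2)\<close>)

text \<open>An element of degree m + 1 has only trivial faces exactly when it is a cycle, and from
  there on both sides obey the same recursion. This moves the kernel of the coskeleton unit up by
  one degree, where it can be compared with an extension of the boundaries.\<close>

lemma cosk_ext_trivial: "cosk_ext X m {\<one>\<^bsub>level X m\<^esub>} = cosk_ext X (Suc m) (moore_cycles X (Suc m))"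
proof
  fix k show "cosk_ext X m {\<one>\<^bsub>level X m\<^esub>} k = cosk_ext X (Suc m) (moore_cycles X (Suc m)) k"
  proof (induction k)
    case 0 then show ?case by simp
  next
    case (Suc k)
    consider "Suc k < m" | "Suc k = m" | "m = k" | "m < k" by linarith
    then show ?case
    proof cases
      case 1
      then show ?thesis by (simp add: cosk_ext_less)
    next
      case 2
      then have "k < Suc m" "Suc k < Suc m" by auto
      then show ?thesis using 2 by (auto simp: cosk_ext_less)
    next
      case 3
      then show ?thesis by (auto simp: cosk_ext_Suc mem_moore_cycles_Suc)
    next
      case 4
      then show ?thesis using Suc by (simp add: cosk_ext_Suc)
    qed
  qed
qed

end

locale simplicial_subquotient =
  H: normal_simplicial_subgroup X H + K: normal_simplicial_subgroup X K
  for X :: "'a sgrp" and H K :: "nat \<Rightarrow> 'a set" +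
  assumes le: "H k \<subseteq> K k"
begin

abbreviation Q :: "'a set sgrp" where "Q \<equiv> subquotient X K H"

definition cl :: "nat \<Rightarrow> 'a \<Rightarrow> 'a set" where "cl k x = H k #>\<^bsub>level X k\<^esub> x"

lemma K_carrier [simp]: "x \<in> K k \<Longrightarrow> x \<in> carrier (level X k)"
  using K.sub.subset by blast

lemma H_carrier [simp]: "x \<in> H k \<Longrightarrow> x \<in> carrier (level X k)"
  using H.sub.subset by blast

lemma carrier_Q: "carrier (level Q k) = cl k ` K k"
  by (auto simp: subquotient_def FactGroup_def RCOSETS_def cl_def)

lemma cl_in [simp]: "x \<in> K k \<Longrightarrow> cl k x \<in> carrier (level Q k)"
  by (simp add: carrier_Q)

lemma one_Q: "\<one>\<^bsub>level Q k\<^esub> = H k"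
  by (simp add: subquotient_def FactGroup_def)

lemma group_Q: "group (level Q k)"
  unfolding subquotient_def
  by (simp add: normal.factorgroup_is_group H.lev.normal_restrict_supergroup H.normal_level
      normal_imp_subgroup K.normal_level le)

lemma mult_cl: "x \<in> K k \<Longrightarrow> y \<in> K k \<Longrightarrow> cl k x \<otimes>\<^bsub>level Q k\<^esub> cl k y = cl k (x \<otimes>\<^bsub>level X k\<^esub> y)"
  using H.sub.rcos_sum[of x k y]
  by (simp add: subquotient_def FactGroup_def cl_def)

lemma cl_eq_one_iff: "x \<in> K k \<Longrightarrow> cl k x = \<one>\<^bsub>level Q k\<^esub> \<longleftrightarrow> x \<in> H k"
  unfolding one_Q cl_def
  by (rule iffI) (auto simp: H.lev.coset_join2 H.sub.subgroup_axioms intro: H.lev.coset_join1)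

lemma cl_hom: "cl k \<in> hom ((level X k)\<lparr>carrier := K k\<rparr>) (level Q k)"
  by (auto simp: hom_def mult_cl)

lemma group_hom_cl: "group_hom ((level X k)\<lparr>carrier := K k\<rparr>) (level Q k) (cl k)"
  by (simp add: group_hom_def group_hom_axioms_def cl_hom group_Q K.sub.subgroup_is_group
      H.lev.is_group)

lemma cl_inv: "x \<in> K k \<Longrightarrow> inv\<^bsub>level Q k\<^esub> (cl k x) = cl k (inv\<^bsub>level X k\<^esub> x)"
  using group_hom.hom_inv[OF group_hom_cl, of x k] K.sub.subgroup_axioms
  by (simp add: H.lev.m_inv_consistent)

lemma coset_image:
  assumes f: "f \<in> hom (level X a) (level X b)" and fH: "\<And>h. h \<in> H a \<Longrightarrow> f h \<in> H b" and x: "x \<in> K a"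
  shows "H b <#>\<^bsub>level X b\<^esub> (f ` cl a x) = H b #>\<^bsub>level X b\<^esub> f x"
proof -
  have fx: "f x \<in> carrier (level X b)" and fh: "\<And>h. h \<in> H a \<Longrightarrow> f (h \<otimes>\<^bsub>level X a\<^esub> x) = f h \<otimes>\<^bsub>level X b\<^esub> f x"
    using f x by (auto simp: hom_def)
  have "H b <#>\<^bsub>level X b\<^esub> (f ` cl a x) = (\<Union>h\<in>H b. \<Union>h'\<in>H a. {h \<otimes>\<^bsub>level X b\<^esub> f h' \<otimes>\<^bsub>level X b\<^esub> f x})"
    using fx fh fH by (auto simp: set_mult_def cl_def r_coset_def H.lev.m_assoc)
  also have "\<dots> = (\<Union>h\<in>H b. {h \<otimes>\<^bsub>level X b\<^esub> f x})"
  proof (intro equalityI subsetI)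
    fix y assume "y \<in> (\<Union>h\<in>H b. \<Union>h'\<in>H a. {h \<otimes>\<^bsub>level X b\<^esub> f h' \<otimes>\<^bsub>level X b\<^esub> f x})"
    then show "y \<in> (\<Union>h\<in>H b. {h \<otimes>\<^bsub>level X b\<^esub> f x})" using fH by blast
  next
    fix y assume "y \<in> (\<Union>h\<in>H b. {h \<otimes>\<^bsub>level X b\<^esub> f x})"
    then obtain h where h: "h \<in> H b" "y = h \<otimes>\<^bsub>level X b\<^esub> f x" by blast
    have "f \<one>\<^bsub>level X a\<^esub> = \<one>\<^bsub>level X b\<^esub>"
      using f by (simp add: hom_one H.lev.is_group)
    then have "y = h \<otimes>\<^bsub>level X b\<^esub> f \<one>\<^bsub>level X a\<^esub> \<otimes>\<^bsub>level X b\<^esub> f x" using h by simp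
    then show "y \<in> (\<Union>h\<in>H b. \<Union>h'\<in>H a. {h \<otimes>\<^bsub>level X b\<^esub> f h' \<otimes>\<^bsub>level X b\<^esub> f x})"
      using h H.sub.one_closed by blast
  qed
  finally show ?thesis by (simp add: r_coset_def)
qed

lemma face_cl: "i \<le> Suc k \<Longrightarrow> x \<in> K (Suc k) \<Longrightarrow> face Q (Suc k) i (cl (Suc k) x) = cl k (face X (Suc k) i x)"
  using coset_image[OF H.face_hom, of i k x] H.face_in by (simp add: subquotient_def cl_def)

lemma degen_cl: "i \<le> k \<Longrightarrow> x \<in> K k \<Longrightarrow> degen Q k i (cl k x) = cl (Suc k) (degen X k i x)"
  using coset_image[OF H.degen_hom, of i k x] H.degen_in by (simp add: subquotient_def cl_def)

lemma simplicial_group_Q: "simplicial_group Q"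
proof (rule simplicial_group.intro)
  fix i k assume i: "i \<le> Suc k"
  show "face Q (Suc k) i \<in> hom (level Q (Suc k)) (level Q k)"
    using i K.face_in by (auto simp: hom_def carrier_Q face_cl mult_cl)
next
  fix i k :: nat assume i: "i \<le> k"
  show "degen Q k i \<in> hom (level Q k) (level Q (Suc k))"
    using i K.degen_in by (auto simp: hom_def carrier_Q degen_cl mult_cl)
next
  fix i j k c assume "i < j" "j \<le> Suc (Suc k)" "c \<in> carrier (level Q (Suc (Suc k)))"
  then show "face Q (Suc k) i (face Q (Suc (Suc k)) j c) = face Q (Suc k) (j - 1) (face Q (Suc (Suc k)) i c)"
    using K.face_in by (auto simp: carrier_Q face_cl H.face_face)
next
  fix i j k c assume "i \<le> j" "j \<le> k" "c \<in> carrier (level Q k)"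
  then show "degen Q (Suc k) i (degen Q k j c) = degen Q (Suc k) (Suc j) (degen Q k i c)"
    using K.degen_in by (auto simp: carrier_Q degen_cl H.degen_degen)
next
  fix i j k c assume "i < j" "j \<le> Suc k" "c \<in> carrier (level Q (Suc k))"
  then show "face Q (Suc (Suc k)) i (degen Q (Suc k) j c) = degen Q k (j - 1) (face Q (Suc k) i c)"
    using K.face_in K.degen_in by (auto simp: carrier_Q degen_cl face_cl H.face_degen_less)
next
  fix i j k c assume "Suc j < i" "i \<le> Suc (Suc k)" "c \<in> carrier (level Q (Suc k))"
  then show "face Q (Suc (Suc k)) i (degen Q (Suc k) j c) = degen Q k j (face Q (Suc k) (i - 1) c)"
    using K.face_in K.degen_in by (auto simp: carrier_Q degen_cl face_cl H.face_degen_greater)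
qed (use K.degen_in group_Q in \<open>auto simp: carrier_Q degen_cl face_cl\<close>)

sublocale Q: simplicial_group Q
  by (rule simplicial_group_Q)

text \<open>If the class of \<open>x\<close> is in the Moore complex, the faces of \<open>x\<close>
  below the last lie in \<open>H\<close>; \<open>moore_representative\<close> corrects
  \<open>x\<close> by an element of \<open>H\<close>, which does not change the class.\<close>

lemma moore_Q: "moore Q k = cl k ` (moore X k \<inter> K k)"
proof (cases k)
  case 0
  then show ?thesis by (auto simp: Q.moore_0 H.moore_0 carrier_Q)
next
  case (Suc j)
  show ?thesis
  proof (intro equalityI subsetI)
    fix c assume c: "c \<in> moore Q k"
    then obtain x where x: "x \<in> K k" "c = cl k x"
      using Q.moore_carrier by (auto simp: carrier_Q)
    have "face X k i x \<in> H (k - 1)" if "i < k" for i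
      using c x that Suc K.face_in[of i j x] cl_eq_one_iff[of "face X (Suc j) i x" j]
      by (simp add: Q.mem_moore_Suc face_cl)
    then obtain h where h: "h \<in> H k" "h \<otimes>\<^bsub>level X k\<^esub> x \<in> moore X k"
      using H.moore_representative[of x k] x by auto
    have hK: "h \<in> K k" using h le by blast
    have "cl k (h \<otimes>\<^bsub>level X k\<^esub> x) = c"
      using h hK x by (metis mult_cl cl_eq_one_iff Q.lev.l_one cl_in)
    then show "c \<in> cl k ` (moore X k \<inter> K k)"
      using h hK x by blast
  next
    fix c assume "c \<in> cl k ` (moore X k \<inter> K k)"
    then obtain x where x: "x \<in> K k" "x \<in> moore X k" "c = cl k x" by blast
    then show "c \<in> moore Q k"
      using Suc K.face_in H.sub.one_closed K.sub.one_closed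
      by (simp add: Q.mem_moore_Suc H.mem_moore_Suc face_cl cl_eq_one_iff)
  qed
qed

lemma mem_moore_cycles_Q:
  assumes "x \<in> moore X (Suc k) \<inter> K (Suc k)"
  shows "cl (Suc k) x \<in> moore_cycles Q (Suc k) \<longleftrightarrow> face X (Suc k) (Suc k) x \<in> H k"
  using assms moore_Q[of "Suc k"] K.face_in[of "Suc k" k x]
  by (auto simp: moore_cycles_def face_cl cl_eq_one_iff)

lemma moore_boundaries_Q:
  "moore_boundaries Q k = cl k ` (face X (Suc k) (Suc k) ` (moore X (Suc k) \<inter> K (Suc k)))"
  by (force simp: moore_boundaries_def moore_Q image_image face_cl)

end

section \<open>Homotopy groups of a subquotient\<close>

context simplicial_group
begin

lemma trivial_homotopy_groupI:
  assumes "moore_cycles X k \<subseteq> moore_boundaries X k"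
  shows "trivial_group (homotopy_group k X)"
proof -
  have eq: "moore_cycles X k = moore_boundaries X k"
    using assms moore_boundaries_subset by blast
  interpret B: normal "moore_boundaries X k" "level X k" by (rule normal_moore_boundaries)
  have "carrier (homotopy_group k X) = (\<lambda>x. moore_boundaries X k #>\<^bsub>level X k\<^esub> x) ` moore_boundaries X k"
    by (auto simp: homotopy_group_def FactGroup_def RCOSETS_def eq)
  also have "\<dots> = (\<lambda>_. moore_boundaries X k) ` moore_boundaries X k"
    by (intro image_cong refl lev.coset_join2) (auto simp: B.subgroup_axioms B.mem_carrier)
  also have "\<dots> = {moore_boundaries X k}" by (rule image_constant[OF B.one_closed])
  finally have "carrier (homotopy_group k X) = {\<one>\<^bsub>homotopy_group k X\<^esub>}"
    by (simp add: homotopy_group_def FactGroup_def)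
  then show ?thesis
    using homotopy_group_group unfolding trivial_group_def by blast
qed

end

context simplicial_subquotient
begin

text \<open>The class of a cycle \<open>x\<close> is sent to the class of
  \<open>cl (Suc n) x\<close>. This is onto because \<open>H\<close> is trivial in degree n, so a
  cycle of the quotient lifts to a genuine cycle. The kernel is the boundaries because
  \<open>H\<close> in degree n + 1 contains nothing else and \<open>K\<close> contains the whole
  Moore complex in degree n + 2.\<close>

lemma homotopy_group_Q_iso:
  assumes Hn: "H n = {\<one>\<^bsub>level X n\<^esub>}"
    and HN: "H (Suc n) \<subseteq> moore_boundaries X (Suc n)"
    and KN: "moore_cycles X (Suc n) \<subseteq> K (Suc n)"
    and KN': "moore X (Suc (Suc n)) \<subseteq> K (Suc (Suc n))"
  shows "homotopy_group (Suc n) X \<cong> homotopy_group (Suc n) Q"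
proof -
  let ?N = "Suc n"
  let ?Z = "moore_cycles X ?N" and ?B = "moore_boundaries X ?N" and ?BQ = "moore_boundaries Q ?N"
  let ?\<phi> = "\<lambda>x. ?BQ #>\<^bsub>level Q ?N\<^esub> cl ?N x"
  interpret BQ: normal ?BQ "level Q ?N" by (rule Q.normal_moore_boundaries)
  have ZK: "x \<in> K ?N" if "x \<in> ?Z" for x using KN that by blast
  have cyc: "cl ?N x \<in> moore_cycles Q ?N" if "x \<in> ?Z" for x
    using that ZK[OF that] H.sub.one_closed
    by (subst mem_moore_cycles_Q) (auto simp: moore_cycles_def)
  have "?\<phi> \<in> hom ((level X ?N)\<lparr>carrier := ?Z\<rparr>) (homotopy_group ?N Q)"
  proof (rule homI)
    fix x assume "x \<in> carrier ((level X ?N)\<lparr>carrier := ?Z\<rparr>)"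
    then show "?\<phi> x \<in> carrier (homotopy_group ?N Q)"
      using cyc by (auto simp: homotopy_group_def FactGroup_def RCOSETS_def)
  next
    fix x y
    assume "x \<in> carrier ((level X ?N)\<lparr>carrier := ?Z\<rparr>)" "y \<in> carrier ((level X ?N)\<lparr>carrier := ?Z\<rparr>)"
    then show "?\<phi> (x \<otimes>\<^bsub>(level X ?N)\<lparr>carrier := ?Z\<rparr>\<^esub> y) = ?\<phi> x \<otimes>\<^bsub>homotopy_group ?N Q\<^esub> ?\<phi> y"
      using ZK by (simp add: homotopy_group_def FactGroup_def BQ.rcos_sum mult_cl)
  qed
  then interpret \<phi>: group_hom "(level X ?N)\<lparr>carrier := ?Z\<rparr>" "homotopy_group ?N Q" ?\<phi>
    by (simp add: group_hom_def group_hom_axioms_def Q.homotopy_group_group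
        subgroup.subgroup_is_group normal_imp_subgroup H.normal_moore_cycles H.lev.is_group)
  have "carrier (homotopy_group ?N Q) \<subseteq> ?\<phi> ` ?Z"
  proof
    fix C assume "C \<in> carrier (homotopy_group ?N Q)"
    then obtain c where c: "c \<in> moore_cycles Q ?N" "C = ?BQ #>\<^bsub>level Q ?N\<^esub> c"
      by (auto simp: homotopy_group_def FactGroup_def RCOSETS_def)
    then obtain x where x: "x \<in> moore X ?N \<inter> K ?N" "c = cl ?N x"
      by (auto simp: moore_cycles_def moore_Q)
    then have "x \<in> ?Z"
      using c mem_moore_cycles_Q[OF x(1)] Hn by (simp add: moore_cycles_def)
    then show "C \<in> ?\<phi> ` ?Z" using c x by blast
  qed
  then have surj: "?\<phi> ` carrier ((level X ?N)\<lparr>carrier := ?Z\<rparr>) = carrier (homotopy_group ?N Q)"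
    using \<phi>.hom_closed by auto
  have BK: "face X (Suc ?N) (Suc ?N) y \<in> K ?N" if "y \<in> moore X (Suc ?N)" for y
    using that KN' K.face_in by auto
  have "kernel ((level X ?N)\<lparr>carrier := ?Z\<rparr>) (homotopy_group ?N Q) ?\<phi> = ?B"
  proof (intro equalityI subsetI)
    fix x assume "x \<in> kernel ((level X ?N)\<lparr>carrier := ?Z\<rparr>) (homotopy_group ?N Q) ?\<phi>"
    then have x: "x \<in> ?Z" "?BQ #>\<^bsub>level Q ?N\<^esub> cl ?N x = ?BQ"
      by (auto simp: kernel_def homotopy_group_def FactGroup_def)
    then have "cl ?N x \<in> ?BQ"
      using Q.lev.coset_join1 ZK cl_in BQ.subgroup_axioms by blast
    then obtain y where y: "y \<in> moore X (Suc ?N)" "cl ?N x = cl ?N (face X (Suc ?N) (Suc ?N) y)"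
      by (auto simp: moore_boundaries_Q)
    let ?b = "face X (Suc ?N) (Suc ?N) y"
    have b: "?b \<in> ?B" "?b \<in> K ?N" using y BK by (auto simp: moore_boundaries_def)
    have "cl ?N (x \<otimes>\<^bsub>level X ?N\<^esub> inv\<^bsub>level X ?N\<^esub> ?b) = cl ?N x \<otimes>\<^bsub>level Q ?N\<^esub> inv\<^bsub>level Q ?N\<^esub> cl ?N ?b"
      using ZK[OF x(1)] b by (simp add: cl_inv mult_cl)
    also have "\<dots> = \<one>\<^bsub>level Q ?N\<^esub>" using y b by simp
    finally have "x \<otimes>\<^bsub>level X ?N\<^esub> inv\<^bsub>level X ?N\<^esub> ?b \<in> ?B"
      using cl_eq_one_iff[of "x \<otimes>\<^bsub>level X ?N\<^esub> inv\<^bsub>level X ?N\<^esub> ?b" ?N] ZK[OF x(1)] b HN by auto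
    then have "x \<otimes>\<^bsub>level X ?N\<^esub> inv\<^bsub>level X ?N\<^esub> ?b \<otimes>\<^bsub>level X ?N\<^esub> ?b \<in> ?B"
      using b normal_imp_subgroup[OF H.normal_moore_boundaries] subgroup.m_closed by metis
    then show "x \<in> ?B" using ZK[OF x(1)] b by (simp add: H.lev.m_assoc)
  next
    fix x assume x: "x \<in> ?B"
    then have "x \<in> ?Z" using H.moore_boundaries_subset by blast
    moreover have "cl ?N x \<in> ?BQ"
      using x KN' unfolding moore_boundaries_Q moore_boundaries_def[of X] by blast
    ultimately show "x \<in> kernel ((level X ?N)\<lparr>carrier := ?Z\<rparr>) (homotopy_group ?N Q) ?\<phi>"
      using ZK by (simp add: kernel_def homotopy_group_def FactGroup_def Q.lev.coset_join2 BQ.subgroup_axioms)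
  qed
  then show ?thesis
    using \<phi>.FactGroup_iso[OF surj] by (simp add: homotopy_group_def)
qed

text \<open>The other homotopy groups vanish for three different reasons: below n the group
  \<open>K\<close> is trivial; in degree n every element of \<open>K\<close> bounds within
  \<open>K\<close>; above n + 1 a cycle of the quotient is represented by an element with all faces
  in \<open>H\<close>, which then lies in \<open>H\<close> since \<open>H\<close> is coskeletal
  there.\<close>

lemma K_simplicial_group_Q:
  assumes Hn: "H n = {\<one>\<^bsub>level X n\<^esub>}"
    and HN: "H (Suc n) \<subseteq> moore_boundaries X (Suc n)"
    and KN: "moore_cycles X (Suc n) \<subseteq> K (Suc n)"
    and KN': "moore X (Suc (Suc n)) \<subseteq> K (Suc (Suc n))"
    and H_cosk: "\<And>k x. n < k \<Longrightarrow> x \<in> carrier (level X (Suc k)) \<Longrightarrow>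
      (\<And>i. i \<le> Suc k \<Longrightarrow> face X (Suc k) i x \<in> H k) \<Longrightarrow> x \<in> H (Suc k)"
    and K_less: "\<And>k. k < n \<Longrightarrow> K k = {\<one>\<^bsub>level X k\<^esub>}"
    and Kn: "K n \<subseteq> face X (Suc n) (Suc n) ` (moore X (Suc n) \<inter> K (Suc n))"
  shows "K_simplicial_group (homotopy_group (Suc n) X) (Suc n) Q"
proof -
  have "moore_cycles Q i \<subseteq> moore_boundaries Q i" if "i \<noteq> Suc n" for i
  proof
    fix c assume c: "c \<in> moore_cycles Q i"
    interpret B: normal "moore_boundaries Q i" "level Q i" by (rule Q.normal_moore_boundaries)
    obtain x where x: "x \<in> moore X i \<inter> K i" "c = cl i x"
      using c by (auto simp: moore_cycles_def moore_Q)
    consider "i < n" | "i = n" | j where "i = Suc j" "n < j"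
    proof -
      have "i < n \<or> i = n \<or> (\<exists>j. i = Suc j \<and> n < j)" using \<open>i \<noteq> Suc n\<close> by presburger
      then show ?thesis using that by blast
    qed
    then show "c \<in> moore_boundaries Q i"
    proof cases
      case 1
      then have "x = \<one>\<^bsub>level X i\<^esub>" using K_less x by blast
      then have "x \<in> H i" using H.sub.one_closed by simp
      then have "c = \<one>\<^bsub>level Q i\<^esub>" using x cl_eq_one_iff by auto
      then show ?thesis by simp
    next
      case 2
      then show ?thesis using x Kn unfolding moore_boundaries_Q by blast
    next
      case 3
      have "face X (Suc j) (Suc j) x \<in> H j"
        using mem_moore_cycles_Q[of x j] x c 3 by simp
      then have "x \<in> H i"
        using x 3 H.sub.one_closed
        by (auto simp: H.mem_moore_Suc intro!: H_cosk elim!: le_SucE)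
      then have "c = \<one>\<^bsub>level Q i\<^esub>" using x cl_eq_one_iff by auto
      then show ?thesis by simp
    qed
  qed
  then show ?thesis
    using homotopy_group_Q_iso[OF Hn HN KN KN']
    by (simp add: K_simplicial_group_def H.homotopy_group_comm simplicial_group_Q
        Q.trivial_homotopy_groupI H.homotopy_group_group group.iso_sym)
qed

end

section \<open>The kernel of the reflection\<close>

lemma simplicial_hom_carrier:
  "simplicial_hom X Y f \<Longrightarrow> x \<in> carrier (level X k) \<Longrightarrow> f k x \<in> carrier (level Y k)"
  by (auto simp: simplicial_hom_def hom_def)

lemma simplicial_hom_face:
  "simplicial_hom X Y f \<Longrightarrow> i \<le> Suc k \<Longrightarrow> x \<in> carrier (level X (Suc k)) \<Longrightarrow>
   face Y (Suc k) i (f (Suc k) x) = f k (face X (Suc k) i x)"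
  by (simp add: simplicial_hom_def)

lemma simplicial_hom_one:
  "simplicial_hom X Y f \<Longrightarrow> simplicial_group X \<Longrightarrow> simplicial_group Y \<Longrightarrow>
   f k \<one>\<^bsub>level X k\<^esub> = \<one>\<^bsub>level Y k\<^esub>"
  by (meson hom_one simplicial_group.group_level simplicial_hom_def)

context simplicial_group
begin

abbreviation cot_kernel :: "nat \<Rightarrow> nat \<Rightarrow> 'a set" where
  "cot_kernel n \<equiv> cosk_ext X n (moore_boundaries X n)"

text \<open>In degree n a boundary is the last face of some \<open>y\<close> whose image lies in the
  Moore complex of \<open>Y\<close> in degree n + 1, hence is trivial. In higher degrees all faces
  of \<open>f k x\<close> are trivial by induction, so it too lies in a vanishing part of that Moore
  complex.\<close>

lemma hom_moore_bounded_trivial: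
  assumes Y: "moore_bounded n Y" and f: "simplicial_hom X Y f"
  shows "x \<in> cot_kernel n k \<Longrightarrow> f k x = \<one>\<^bsub>level Y k\<^esub>"
proof (induction k arbitrary: x rule: less_induct)
  case (less k)
  interpret Y: simplicial_group Y using Y by (simp add: moore_bounded_def)
  note one = simplicial_hom_one[OF f simplicial_group_axioms Y.simplicial_group_axioms]
  have bounded: "z = \<one>\<^bsub>level Y j\<^esub>" if "z \<in> moore Y j" "n < j" for z j
    using Y that by (auto simp: moore_bounded_def)
  consider "k < n" | "k = n" | j where "k = Suc j" "n \<le> j"
  proof -
    have "k < n \<or> k = n \<or> (\<exists>j. k = Suc j \<and> n \<le> j)" by presburger
    then show ?thesis using that by blast
  qed
  then show ?case
  proof cases
    case 1
    then show ?thesis using less.prems one by (simp add: cosk_ext_less)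
  next
    case 2
    then obtain y where y: "y \<in> moore X (Suc n)" "x = face X (Suc n) (Suc n) y"
      using less.prems by (auto simp: moore_boundaries_def)
    then have "f (Suc n) y \<in> moore Y (Suc n)"
      by (auto simp: mem_moore_Suc Y.mem_moore_Suc simplicial_hom_carrier[OF f]
          simplicial_hom_face[OF f] one)
    then have "f (Suc n) y = \<one>\<^bsub>level Y (Suc n)\<^esub>"
      using bounded by simp
    then show ?thesis
      using y 2 simplicial_hom_face[OF f, of "Suc n" n y] by (simp add: mem_moore_Suc)
  next
    case 3
    then have x: "x \<in> carrier (level X (Suc j))" "\<And>i. i \<le> Suc j \<Longrightarrow> face X (Suc j) i x \<in> cot_kernel n j"
      using less.prems by (auto simp: cosk_ext_Suc)
    then have "f (Suc j) x \<in> moore Y (Suc j)"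
      using less.IH[of j] 3
      by (simp add: Y.mem_moore_Suc simplicial_hom_carrier[OF f] simplicial_hom_face[OF f])
    then show ?thesis using bounded 3 by simp
  qed
qed

lemma moore_cycles_subset_cosk_ext:
  assumes "S \<lhd> level X m" "m \<le> k"
  shows "moore_cycles X (Suc k) \<subseteq> cosk_ext X m S (Suc k)"
  using assms normal_imp_subgroup[OF normal_cosk_ext[OF assms(1)], THEN subgroup.one_closed]
  by (auto simp: cosk_ext_Suc mem_moore_cycles_Suc)

text \<open>Only the last face of a Moore element can be nontrivial, and it is a boundary: in degree
  n this is the defining condition, above n a boundary is a cycle and so belongs to the
  extension.\<close>

lemma moore_subset_cot_kernel:
  assumes "n \<le> k" shows "moore X (Suc k) \<subseteq> cot_kernel n (Suc k)"
proof
  fix x assume x: "x \<in> moore X (Suc k)"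
  have "face X (Suc k) (Suc k) x \<in> moore_boundaries X k"
    using x by (auto simp: moore_boundaries_def)
  moreover have "moore_boundaries X k \<subseteq> cot_kernel n k"
  proof (cases "n = k")
    case True then show ?thesis by simp
  next
    case False
    then obtain j where "k = Suc j" "n \<le> j" using assms by (cases k) auto
    then show ?thesis
      using moore_boundaries_subset moore_cycles_subset_cosk_ext[OF normal_moore_boundaries] by blast
  qed
  ultimately show "x \<in> cot_kernel n (Suc k)"
    using x assms normal_imp_subgroup[OF normal_cosk_ext[OF normal_moore_boundaries], THEN subgroup.one_closed]
    by (auto simp: cosk_ext_Suc mem_moore_Suc elim!: le_SucE)
qed

definition cot_quotient :: "nat \<Rightarrow> 'a set sgrp" where
  "cot_quotient n = subquotient X (\<lambda>k. carrier (level X k)) (cot_kernel n)"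

definition cot_proj :: "nat \<Rightarrow> nat \<Rightarrow> 'a \<Rightarrow> 'a set" where
  "cot_proj n k x = cot_kernel n k #>\<^bsub>level X k\<^esub> x"

lemma simplicial_subquotient_cot:
  "simplicial_subquotient X (cot_kernel n) (\<lambda>k. carrier (level X k))"
  by (intro simplicial_subquotient.intro simplicial_subquotient_axioms.intro
      normal_simplicial_subgroup_carrier normal_simplicial_subgroup_cosk_ext
      normal_moore_boundaries moore_boundaries_subset
      subgroup.subset normal_imp_subgroup normal_cosk_ext)

lemma cot_proj_eq_one_iff:
  "x \<in> carrier (level X k) \<Longrightarrow> cot_proj n k x = \<one>\<^bsub>level (cot_quotient n) k\<^esub> \<longleftrightarrow> x \<in> cot_kernel n k"
  using simplicial_subquotient.cl_eq_one_iff[OF simplicial_subquotient_cot, of x k n]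
  by (simp add: cot_proj_def cot_quotient_def simplicial_subquotient.cl_def[OF simplicial_subquotient_cot])

text \<open>The quotient is bounded because \<open>cot_kernel n\<close> contains the Moore complex
  above degree n; morphisms descend to it because every morphism to a bounded object kills
  \<open>cot_kernel n\<close>. Uniqueness is surjectivity of the projection.\<close>

lemma is_reflection_cot: "is_reflection n X (cot_quotient n) (cot_proj n)"
proof -
  interpret C: simplicial_subquotient X "cot_kernel n" "\<lambda>k. carrier (level X k)"
    by (rule simplicial_subquotient_cot)
  have cq: "C.Q = cot_quotient n" and cl: "C.cl = cot_proj n"
    by (simp_all add: cot_quotient_def cot_proj_def C.cl_def fun_eq_iff)
  have "moore (cot_quotient n) i = {\<one>\<^bsub>level (cot_quotient n) i\<^esub>}" if i: "n < i" for i
  proof -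
    obtain j where j: "i = Suc j" "n \<le> j" using i by (cases i) auto
    have "moore (cot_quotient n) i \<subseteq> {\<one>\<^bsub>level (cot_quotient n) i\<^esub>}"
    proof
      fix c assume "c \<in> moore (cot_quotient n) i"
      then obtain x where "x \<in> moore X i" "c = C.cl i x"
        unfolding cq[symmetric] C.moore_Q by blast
      then show "c \<in> {\<one>\<^bsub>level (cot_quotient n) i\<^esub>}"
        using moore_subset_cot_kernel[OF j(2)] j moore_carrier C.cl_eq_one_iff[of x i]
        by (auto simp: cq)
    qed
    then show ?thesis
      using normal_imp_subgroup[OF C.Q.normal_moore, THEN subgroup.one_closed, of i] cq by auto
  qed
  then have bounded: "moore_bounded n (cot_quotient n)"
    using C.simplicial_group_Q cq by (simp add: moore_bounded_def)
  have hom: "simplicial_hom X (cot_quotient n) (cot_proj n)"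
    unfolding simplicial_hom_def cq[symmetric] cl[symmetric]
    by (auto simp: hom_def C.mult_cl C.face_cl C.degen_cl)
  have univ: "\<exists>g. simplicial_hom (cot_quotient n) Y g \<and>
        (\<forall>k. \<forall>x\<in>carrier (level X k). g k (cot_proj n k x) = f k x) \<and>
        (\<forall>g'. simplicial_hom (cot_quotient n) Y g' \<and> (\<forall>k. \<forall>x\<in>carrier (level X k). g' k (cot_proj n k x) = f k x)
           \<longrightarrow> (\<forall>k. \<forall>c\<in>carrier (level (cot_quotient n) k). g' k c = g k c))"
    if Y: "moore_bounded n Y" and f: "simplicial_hom X Y f" for Y :: "'c sgrp" and f
  proof -
    interpret Y: simplicial_group Y using Y by (simp add: moore_bounded_def)
    \<comment> \<open>A preimage is chosen for each coset; the value does not depend on it, since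
      two preimages differ by an element of \<open>cot_kernel n\<close>.\<close>
    define g where "g = (\<lambda>k c. f k (SOME x. x \<in> carrier (level X k) \<and> cot_proj n k x = c))"
    have g: "g k (cot_proj n k x) = f k x" if x: "x \<in> carrier (level X k)" for k x
    proof -
      define y where "y = (SOME y. y \<in> carrier (level X k) \<and> cot_proj n k y = cot_proj n k x)"
      have y: "y \<in> carrier (level X k)" "cot_proj n k y = cot_proj n k x"
        using someI[of "\<lambda>y. y \<in> carrier (level X k) \<and> cot_proj n k y = cot_proj n k x" x] x
        by (auto simp: y_def)
      interpret f: group_hom "level X k" "level Y k" "f k"
        using f by (simp add: group_hom_def group_hom_axioms_def simplicial_hom_def)
      have "C.cl k (y \<otimes>\<^bsub>level X k\<^esub> inv\<^bsub>level X k\<^esub> x) = C.cl k y \<otimes>\<^bsub>level C.Q k\<^esub> inv\<^bsub>level C.Q k\<^esub> C.cl k x"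
        using x y(1) by (simp add: C.mult_cl C.cl_inv)
      also have "C.cl k y = C.cl k x" using y cl by simp
      finally have "C.cl k (y \<otimes>\<^bsub>level X k\<^esub> inv\<^bsub>level X k\<^esub> x) = C.cl k x \<otimes>\<^bsub>level C.Q k\<^esub> inv\<^bsub>level C.Q k\<^esub> C.cl k x" .
      then have "C.cl k (y \<otimes>\<^bsub>level X k\<^esub> inv\<^bsub>level X k\<^esub> x) = \<one>\<^bsub>level C.Q k\<^esub>"
        using x by simp
      then have "y \<otimes>\<^bsub>level X k\<^esub> inv\<^bsub>level X k\<^esub> x \<in> cot_kernel n k"
        using x y by (simp add: C.cl_eq_one_iff)
      then have "f k (y \<otimes>\<^bsub>level X k\<^esub> inv\<^bsub>level X k\<^esub> x) = \<one>\<^bsub>level Y k\<^esub>"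
        by (rule hom_moore_bounded_trivial[OF Y f])
      then have "f k y = f k x"
        using x y by (simp add: Y.lev.inv_solve_right')
      then show ?thesis by (simp add: g_def y_def)
    qed
    have carr: "carrier (level (cot_quotient n) k) = cot_proj n k ` carrier (level X k)" for k
      using C.carrier_Q by (simp add: cq cl)
    have "simplicial_hom (cot_quotient n) Y g"
    proof -
      have "g k \<in> hom (level (cot_quotient n) k) (level Y k)" for k
        using f C.mult_cl[of _ k] unfolding cq cl
        by (auto simp: hom_def carr g simplicial_hom_carrier simplicial_hom_def)
      moreover have "g k (face (cot_quotient n) (Suc k) i c) = face Y (Suc k) i (g (Suc k) c)"
        if "i \<le> Suc k" "c \<in> carrier (level (cot_quotient n) (Suc k))" for k i c
        using that f C.face_cl[of i k] unfolding cq cl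
        by (auto simp: carr g simplicial_hom_face)
      moreover have "g (Suc k) (degen (cot_quotient n) k i c) = degen Y k i (g k c)"
        if "i \<le> k" "c \<in> carrier (level (cot_quotient n) k)" for k i c
        using that f C.degen_cl[of i k] unfolding cq cl
        by (auto simp: carr g simplicial_hom_def)
      ultimately show ?thesis by (simp add: simplicial_hom_def)
    qed
    then show ?thesis using g carr by (intro exI[of _ g]) auto
  qed
  show ?thesis unfolding is_reflection_def using bounded hom univ by blast
qed

text \<open>The explicit reflection guarantees that the choice behind \<open>Cot\<close> yields a
  reflection. One inclusion holds because \<open>cot_proj n\<close> factors through the unit of
  \<open>Cot\<close>, the other because that unit is a morphism to a bounded object. The explicit
  quotient has element type \<open>'a set\<close>, so it is an admissible test object.\<close>

lemma mu_Cot_eq: "mu_Cot n X = cot_kernel n"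
proof
  fix k
  have refl: "is_reflection n X (Cot n X) (Cot_unit n X)"
    using someI[of "\<lambda>p. is_reflection n X (fst p) (snd p)" "(cot_quotient n, cot_proj n)"]
      is_reflection_cot[of n]
    by (simp add: Cot_def Cot_unit_def Cot_with_unit_def)
  then have C: "moore_bounded n (Cot n X)" "simplicial_hom X (Cot n X) (Cot_unit n X)"
    by (auto simp: is_reflection_def)
  have Q: "moore_bounded n (cot_quotient n)" "simplicial_hom X (cot_quotient n) (cot_proj n)"
    using is_reflection_cot by (auto simp: is_reflection_def)
  obtain g where g: "simplicial_hom (Cot n X) (cot_quotient n) g"
    "\<And>k x. x \<in> carrier (level X k) \<Longrightarrow> g k (Cot_unit n X k x) = cot_proj n k x"
    using refl Q unfolding is_reflection_def by metis
  show "mu_Cot n X k = cot_kernel n k"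
  proof (intro equalityI subsetI)
    fix x assume "x \<in> mu_Cot n X k"
    then have x: "x \<in> carrier (level X k)" "Cot_unit n X k x = \<one>\<^bsub>level (Cot n X) k\<^esub>"
      by (auto simp: mu_Cot_def kernel_def)
    have "cot_proj n k x = \<one>\<^bsub>level (cot_quotient n) k\<^esub>"
      using g(2)[OF x(1)] x(2) simplicial_hom_one[OF g(1)] C Q by (simp add: moore_bounded_def)
    then show "x \<in> cot_kernel n k" using x cot_proj_eq_one_iff by blast
  next
    fix x assume x: "x \<in> cot_kernel n k"
    then have "x \<in> carrier (level X k)"
      using normal_imp_subgroup[OF normal_cosk_ext[OF normal_moore_boundaries], THEN subgroup.subset] by blast
    then show "x \<in> mu_Cot n X k"
      using hom_moore_bounded_trivial[OF C x] by (simp add: mu_Cot_def kernel_def)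
  qed
qed

end

section \<open>Operators of monotone maps\<close>

text \<open>Composing with \<open>d_i\<close> on the right: the word is put back into decreasing order by
  \<open>d_j d_i = d_i d_(j+1)\<close> for \<open>i \<le> j\<close>.\<close>

fun face_insert :: "nat \<Rightarrow> nat list \<Rightarrow> nat list" where
  "face_insert i [] = [i]"
| "face_insert i (j # js) = (if j < i then i # j # js else Suc j # face_insert i js)"

definition missing :: "nat \<Rightarrow> nat list \<Rightarrow> nat list" where
  "missing k \<theta> = rev (filter (\<lambda>j. j \<notin> set \<theta>) [0..<Suc k])"

lemma set_face_insert:
  "sorted_wrt (>) js \<Longrightarrow> set (face_insert i js) = insert i (delta i ` set js)"
  by (induction i js rule: face_insert.induct) (auto simp: delta_def)

lemma sorted_face_insert: "sorted_wrt (>) js \<Longrightarrow> sorted_wrt (>) (face_insert i js)"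
proof (induction i js rule: face_insert.induct)
  case (2 i j js)
  show ?case
  proof (cases "j < i")
    case True then show ?thesis using 2 by auto
  next
    case False
    then show ?thesis using 2 by (force simp: set_face_insert delta_def)
  qed
qed simp

lemma inj_delta: "inj (delta i)"
  by (auto simp: inj_def delta_def split: if_splits)

lemma sorted_map_delta: "sorted \<theta> \<Longrightarrow> sorted (map (delta i) \<theta>)"
  unfolding sorted_map by (erule sorted_wrt_mono_rel[rotated]) (auto simp: delta_def)

lemma mem_delta_image: "l \<in> delta i ` A \<longleftrightarrow> l \<noteq> i \<and> sigma i l \<in> A" 
proof
  assume "l \<noteq> i \<and> sigma i l \<in> A"
  moreover from this have "l = delta i (sigma i l)" by (auto simp: delta_def sigma_def)
  ultimately show "l \<in> delta i ` A" by blast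
qed (auto simp: delta_def sigma_def)

lemma sorted_missing: "sorted_wrt (>) (missing k \<theta>)"
  by (simp add: missing_def sorted_wrt_rev sorted_wrt_filter)

lemma set_missing: "set (missing k \<theta>) = {..k} - set \<theta>"
  by (auto simp: missing_def less_Suc_eq_le simp del: upt_Suc)

lemma length_missing:
  assumes "set \<theta> \<subseteq> {..k}" shows "length (missing k \<theta>) = Suc k - card (set \<theta>)"
proof -
  have "distinct (missing k \<theta>)" by (simp add: missing_def)
  then have "length (missing k \<theta>) = card ({..k} - set \<theta>)"
    by (metis distinct_card set_missing)
  then show ?thesis using assms by (simp add: card_Diff_subset)
qed

text \<open>The composite of \<theta> with the i-th coface misses i and the shifts of the values
  missed by \<theta>. Both lists are strictly decreasing, so equality of their sets is
  enough.\<close>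

lemma face_insert_missing:
  assumes "i \<le> Suc k"
  shows "face_insert i (missing k \<theta>) = missing (Suc k) (map (delta i) \<theta>)"
proof -
  have "{..Suc k} - delta i ` set \<theta> = insert i (delta i ` ({..k} - set \<theta>))"
    using assms by (auto simp: mem_delta_image) (auto simp: delta_def sigma_def split: if_splits)
  then have "set (face_insert i (missing k \<theta>)) = set (missing (Suc k) (map (delta i) \<theta>))"
    by (simp add: set_face_insert sorted_missing set_missing)
  then have "rev (face_insert i (missing k \<theta>)) = rev (missing (Suc k) (map (delta i) \<theta>))"
    by (intro strict_sorted_equal) (auto simp: sorted_wrt_rev sorted_face_insert sorted_missing)
  then show ?thesis by simp
qed

lemma card_set_pos: "\<theta> \<noteq> [] \<Longrightarrow> 0 < card (set \<theta>)"
  by (simp add: card_gt_0_iff)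

text \<open>Each step of a sorted list either repeats a value or introduces a new one. This count
  shows that the degeneracy word in the operator of \<theta> ends in degree
  \<open>length \<theta> - 1\<close>.\<close>

lemma length_repeats:
  "sorted \<theta> \<Longrightarrow> \<theta> \<noteq> [] \<Longrightarrow>
   length (filter (\<lambda>i. \<theta> ! i = \<theta> ! Suc i) [0..<length \<theta> - 1]) + card (set \<theta>) = length (\<theta> :: nat list)"
proof (induction \<theta>)
  case (Cons a \<theta>)
  show ?case
  proof (cases \<theta>)
    case (Cons b \<rho>)
    have "[0..<length \<rho> + 1] = 0 # map Suc [0..<length \<rho>]"
      by (simp add: map_Suc_upt upt_conv_Cons del: upt_Suc)
    then have "length (filter (\<lambda>i. (a # \<theta>) ! i = (a # \<theta>) ! Suc i) [0..<length (a # \<theta>) - 1]) =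
      (if a = b then 1 else 0) + length (filter (\<lambda>i. \<theta> ! i = \<theta> ! Suc i) [0..<length \<theta> - 1])"
      by (simp add: Cons filter_map o_def del: upt_Suc)
    moreover have "card (set (a # \<theta>)) = (if a = b then 0 else 1) + card (set \<theta>)"
      using Cons.prems Cons by (auto simp: card_insert_if)
    ultimately show ?thesis using Cons.IH Cons.prems Cons by simp
  qed simp
qed simp

context simplicial_group
begin

text \<open>The bound on the length keeps every degree met along the word positive, so that two
  faces can be commuted at each step.\<close>

lemma face_word_face:
  "sorted_wrt (>) js \<Longrightarrow> set js \<subseteq> {..k} \<Longrightarrow> length js \<le> k \<Longrightarrow> i \<le> Suc k \<Longrightarrow>
   x \<in> carrier (level X (Suc k)) \<Longrightarrow>
   face_word X k js (face X (Suc k) i x) = face_word X (Suc k) (face_insert i js) x"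
proof (induction js arbitrary: k i x)
  case Nil then show ?case by simp
next
  case (Cons j js)
  then obtain k' where k': "k = Suc k'" by (cases k) auto
  show ?case
  proof (cases "j < i")
    case True then show ?thesis by (simp add: k')
  next
    case False
    have "face X (Suc k') j (face X (Suc (Suc k')) i x) = face X (Suc k') i (face X (Suc (Suc k')) (Suc j) x)"
      using face_face[of i "Suc j" k' x] False Cons.prems k' by simp
    moreover have "set js \<subseteq> {..k'}" using Cons.prems k' by auto
    ultimately show ?thesis
      using Cons.IH[of k' i "face X (Suc (Suc k')) (Suc j) x"] Cons.prems False k' by simp
  qed
qed

lemma face_word_mem:
  assumes M: "\<And>k i h. i \<le> Suc k \<Longrightarrow> h \<in> M (Suc k) \<Longrightarrow> face X (Suc k) i h \<in> M k"
  shows "sorted_wrt (>) js \<Longrightarrow> set js \<subseteq> {..k} \<Longrightarrow> length js \<le> k \<Longrightarrow> x \<in> M k \<Longrightarrow>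
    face_word X k js x \<in> M (k - length js)"
proof (induction js arbitrary: k x)
  case (Cons j js)
  then obtain k' where k': "k = Suc k'" by (cases k) auto
  have "set js \<subseteq> {..k'}" using Cons.prems k' by auto
  then show ?case using Cons M[of j k' x] k' by simp
qed simp

lemma degen_word_one:
  "sorted_wrt (<) js \<Longrightarrow> set js \<subseteq> {..<p + length js} \<Longrightarrow>
   degen_word X p js \<one>\<^bsub>level X p\<^esub> = \<one>\<^bsub>level X (p + length js)\<^esub>"
proof (induction js arbitrary: p)
  case (Cons j js)
  have "distinct js" using Cons.prems strict_sorted_iff by auto
  then have "length js = card (set js)" by (simp add: distinct_card)
  \<comment> \<open>The entries of \<open>js\<close> are distinct and all lie in this interval,
    which has \<open>p + length js - j\<close> elements; hence \<open>j \<le> p\<close> and the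
    first degeneracy is legitimate.\<close>
  also have "\<dots> \<le> card {Suc j..<p + Suc (length js)}"
    using Cons.prems by (intro card_mono) (auto simp: Suc_le_eq subset_iff)
  finally have "j \<le> p" using Cons.prems by auto
  then show ?case using Cons.IH[of "Suc p"] Cons.prems by simp
qed simp

text \<open>The face-closed family \<open>M\<close> is left arbitrary because the carriers, the
  trivial subgroups and a coskeletal extension all occur.\<close>

lemma face_word_missing_mem:
  assumes M: "\<And>k i h. i \<le> Suc k \<Longrightarrow> h \<in> M (Suc k) \<Longrightarrow> face X (Suc k) i h \<in> M k"
    and \<theta>: "\<theta> \<noteq> []" "set \<theta> \<subseteq> {..k}" and x: "x \<in> M k"
  shows "face_word X k (missing k \<theta>) x \<in> M (card (set \<theta>) - 1)"
proof -
  have "card (set \<theta>) \<le> Suc k" using card_mono[OF _ \<theta>(2)] by simp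
  moreover have "card (set \<theta>) > 0" using \<theta> by (rule_tac card_set_pos)
  ultimately have "length (missing k \<theta>) \<le> k" "k - length (missing k \<theta>) = card (set \<theta>) - 1"
    using length_missing[OF \<theta>(2)] by auto
  then show ?thesis
    using face_word_mem[of M "missing k \<theta>" k x] M x sorted_missing set_missing by auto
qed

lemma face_word_missing_face:
  assumes "\<theta> \<noteq> []" "set \<theta> \<subseteq> {..k}" "i \<le> Suc k" "x \<in> carrier (level X (Suc k))"
  shows "face_word X k (missing k \<theta>) (face X (Suc k) i x) =
    face_word X (Suc k) (missing (Suc k) (map (delta i) \<theta>)) x"
proof -
  have "length (missing k \<theta>) \<le> k"
    using length_missing[OF assms(2)] card_set_pos[OF assms(1)] by simp
  then show ?thesis
    using face_word_face[of "missing k \<theta>" k i x] assms face_insert_missing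
    by (auto simp: sorted_missing set_missing)
qed

text \<open>Composing with an injective coface changes neither the positions of repetitions nor the
  number of values, so the degeneracy word is the same and only the face word needs an
  argument.\<close>

lemma simplicial_operator_face:
  assumes "\<theta> \<noteq> []" "set \<theta> \<subseteq> {..k}" "i \<le> Suc k" "x \<in> carrier (level X (Suc k))"
  shows "simplicial_operator X k \<theta> (face X (Suc k) i x) = simplicial_operator X (Suc k) (map (delta i) \<theta>) x"
proof -
  have "filter (\<lambda>j. map (delta i) \<theta> ! j = map (delta i) \<theta> ! Suc j) [0..<length \<theta> - 1] =
    filter (\<lambda>j. \<theta> ! j = \<theta> ! Suc j) [0..<length \<theta> - 1]"
    by (intro filter_cong refl) (auto simp: inj_eq[OF inj_delta])
  moreover have "card (delta i ` set \<theta>) = card (set \<theta>)"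
    by (rule card_image) (rule inj_on_subset[OF inj_delta], simp)
  ultimately show ?thesis
    using face_word_missing_face[OF assms] by (simp add: simplicial_operator_def missing_def)
qed

lemma simplicial_operator_id: "simplicial_operator X k [0..<Suc k] x = x"
proof -
  have "filter (\<lambda>i. [0..<Suc k] ! i = [0..<Suc k] ! Suc i) [0..<length [0..<Suc k] - 1] = []"
    by (auto simp: filter_empty_conv simp del: upt_Suc)
  moreover have "filter (\<lambda>j. j \<notin> set [0..<Suc k]) [0..<Suc k] = []"
    by (auto simp: filter_empty_conv simp del: upt_Suc)
  ultimately show ?thesis by (simp add: simplicial_operator_def del: upt_Suc)
qed

lemma mem_mu_cosk_iff:
  "x \<in> mu_cosk (Suc m) X k \<longleftrightarrow> x \<in> carrier (level X k) \<and>
     (\<forall>\<theta>\<in>monotone_maps m k. simplicial_operator X k \<theta> x = \<one>\<^bsub>level X (length \<theta> - 1)\<^esub>)"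
proof -
  have "\<one>\<^bsub>level (cosk m (tr m X)) k\<^esub> = (\<lambda>\<theta>\<in>monotone_maps m k. \<one>\<^bsub>level X (length \<theta> - 1)\<^esub>)"
    by (auto simp: cosk_def cosk_level_def tr_def monotone_maps_def restrict_def fun_eq_iff)
  then show ?thesis
    by (auto simp: mu_cosk_def kernel_def cosk_unit_def restrict_def fun_eq_iff)
qed

text \<open>In degrees up to m the identity is one of the indices, so the kernel is trivial; above,
  composing indices with cofaces shows that faces stay in the kernel. Conversely, the face word of
  an index carries an element of the extension to degree at most m, where the extension is
  trivial.\<close>

lemma mu_cosk_eq: "mu_cosk (Suc m) X = cosk_ext X m {\<one>\<^bsub>level X m\<^esub>}"
proof
  have low: "x \<in> cosk_ext X m {\<one>\<^bsub>level X m\<^esub>} k" if x: "x \<in> mu_cosk (Suc m) X k" "k \<le> m" for x k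
  proof -
    have "[0..<Suc k] \<in> monotone_maps m k"
      using that by (auto simp: monotone_maps_def simp del: upt_Suc)
    then have "x = \<one>\<^bsub>level X k\<^esub>"
      using x simplicial_operator_id[of k x] by (auto simp: mem_mu_cosk_iff simp del: upt_Suc)
    then show ?thesis using that by (cases "k = m") (auto simp: cosk_ext_less)
  qed
  fix k show "mu_cosk (Suc m) X k = cosk_ext X m {\<one>\<^bsub>level X m\<^esub>} k"
  proof (intro equalityI subsetI)
    fix x assume "x \<in> mu_cosk (Suc m) X k"
    then show "x \<in> cosk_ext X m {\<one>\<^bsub>level X m\<^esub>} k"
    proof (induction k arbitrary: x)
      case 0
      then show ?case using low by blast
    next
      case (Suc k)
      show ?case
      proof (cases "Suc k \<le> m")
        case True
        then show ?thesis using low Suc.prems by blast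
      next
        case False
        have x: "x \<in> carrier (level X (Suc k))"
          using Suc.prems by (simp add: mem_mu_cosk_iff)
        have "face X (Suc k) i x \<in> mu_cosk (Suc m) X k" if i: "i \<le> Suc k" for i
        proof -
          have "simplicial_operator X k \<theta> (face X (Suc k) i x) = \<one>\<^bsub>level X (length \<theta> - 1)\<^esub>"
            if \<theta>: "\<theta> \<in> monotone_maps m k" for \<theta>
          proof -
            have "map (delta i) \<theta> \<in> monotone_maps m (Suc k)"
              using \<theta> by (auto simp: monotone_maps_def sorted_map_delta) (auto simp: delta_def)
            moreover have "simplicial_operator X k \<theta> (face X (Suc k) i x) =
              simplicial_operator X (Suc k) (map (delta i) \<theta>) x"
              using \<theta> i x by (intro simplicial_operator_face) (auto simp: monotone_maps_def)
            ultimately show ?thesis using Suc.prems by (auto simp: mem_mu_cosk_iff)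
          qed
          then show ?thesis using x i by (simp add: mem_mu_cosk_iff)
        qed
        then show ?thesis using Suc.IH x False by (simp add: cosk_ext_Suc)
      qed
    qed
  next
    fix x assume x: "x \<in> cosk_ext X m {\<one>\<^bsub>level X m\<^esub>} k"
    interpret E: normal_simplicial_subgroup X "cosk_ext X m {\<one>\<^bsub>level X m\<^esub>}"
      by (intro normal_simplicial_subgroup_cosk_ext lev.one_is_normal)
        (use normal_imp_subgroup[OF normal_moore_cycles, THEN subgroup.one_closed] in auto)
    have "simplicial_operator X k \<theta> x = \<one>\<^bsub>level X (length \<theta> - 1)\<^esub>" if \<theta>: "\<theta> \<in> monotone_maps m k" for \<theta>
    proof -
      let ?p = "card (set \<theta>) - 1"
      let ?js = "filter (\<lambda>i. \<theta> ! i = \<theta> ! Suc i) [0..<length \<theta> - 1]"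
      have ne: "\<theta> \<noteq> []" "set \<theta> \<subseteq> {..k}" "sorted \<theta>" "length \<theta> \<le> Suc m"
        using \<theta> by (auto simp: monotone_maps_def)
      have "face_word X k (missing k \<theta>) x \<in> cosk_ext X m {\<one>\<^bsub>level X m\<^esub>} ?p"
        by (rule face_word_missing_mem) (use ne x E.face_in in auto)
      \<comment> \<open>\<open>?p + 1\<close> is the number of values of \<theta>, which is bounded
        by its length and so by m + 1.\<close>
      moreover have "?p \<le> m" using ne card_length[of \<theta>] by simp
      ultimately have "face_word X k (missing k \<theta>) x = \<one>\<^bsub>level X ?p\<^esub>"
        by (cases "?p = m") (auto simp: cosk_ext_less)
      moreover have len: "?p + length ?js = length \<theta> - 1"
        using length_repeats[OF ne(3,1)] card_set_pos[OF ne(1)] by simp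
      moreover have "degen_word X ?p ?js \<one>\<^bsub>level X ?p\<^esub> = \<one>\<^bsub>level X (?p + length ?js)\<^esub>"
        by (rule degen_word_one) (use len in \<open>auto simp: sorted_wrt_filter\<close>)
      ultimately show ?thesis by (simp add: simplicial_operator_def missing_def)
    qed
    then show "x \<in> mu_cosk (Suc m) X k" using x E.sub.subset by (auto simp: mem_mu_cosk_iff)
  qed
qed

end

section \<open>Lists as monotone maps\<close>

lemma length_delete_at: "i < length \<theta> \<Longrightarrow> length (delete_at i \<theta>) = length \<theta> - 1"
  by (simp add: delete_at_def)

lemma nth_delete_at: "i < length \<theta> \<Longrightarrow> j < length \<theta> - 1 \<Longrightarrow> delete_at i \<theta> ! j = \<theta> ! delta i j"
  by (auto simp: delete_at_def delta_def nth_append)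

lemma delete_at_map: "delete_at i (map f \<theta>) = map f (delete_at i \<theta>)"
  by (simp add: delete_at_def take_map drop_map)

lemma set_delete_at: "set (delete_at i \<theta>) \<subseteq> set \<theta>"
  by (auto simp: delete_at_def dest: in_set_takeD in_set_dropD)

lemma sorted_delete_at: assumes "sorted (\<theta> :: nat list)" shows "sorted (delete_at i \<theta>)"
proof (cases "i < length \<theta>")
  case True
  show ?thesis
    unfolding sorted_iff_nth_mono
  proof (intro allI impI)
    fix a b assume ab: "a \<le> b" "b < length (delete_at i \<theta>)"
    then have "delta i a \<le> delta i b" "delta i b < length \<theta>"
      using True by (auto simp: length_delete_at delta_def)
    then show "delete_at i \<theta> ! a \<le> delete_at i \<theta> ! b"
      using ab True assms by (simp add: length_delete_at nth_delete_at sorted_nth_mono)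
  qed
qed (use assms in \<open>simp add: delete_at_def\<close>)

lemma length_repeat_at: "i < length \<theta> \<Longrightarrow> length (repeat_at i \<theta>) = Suc (length \<theta>)"
  by (simp add: repeat_at_def)

lemma nth_repeat_at: "i < length \<theta> \<Longrightarrow> j \<le> length \<theta> \<Longrightarrow> repeat_at i \<theta> ! j = \<theta> ! sigma i j"
  by (cases "length \<theta> = Suc i") (auto simp: repeat_at_def sigma_def nth_append min_def)

lemma repeat_at_map: "repeat_at i (map f \<theta>) = map f (repeat_at i \<theta>)"
  by (simp add: repeat_at_def take_map drop_map)

lemma set_repeat_at: "set (repeat_at i \<theta>) \<subseteq> set \<theta>"
  by (auto simp: repeat_at_def dest: in_set_takeD in_set_dropD)

lemma sorted_repeat_at:
  assumes "sorted (\<theta> :: nat list)" "i < length \<theta>" shows "sorted (repeat_at i \<theta>)"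
  unfolding sorted_iff_nth_mono
proof (intro allI impI)
  fix a b assume ab: "a \<le> b" "b < length (repeat_at i \<theta>)"
  then have "sigma i a \<le> sigma i b" "sigma i b < length \<theta>"
    using assms(2) by (auto simp: length_repeat_at sigma_def)
  then show "repeat_at i \<theta> ! a \<le> repeat_at i \<theta> ! b"
    using ab assms by (simp add: length_repeat_at nth_repeat_at sorted_nth_mono)
qed

lemma not_distinct_repeat_at: "i < length \<theta> \<Longrightarrow> \<not> distinct (repeat_at i \<theta>)"
  using nth_eq_iff_index_eq[of "repeat_at i \<theta>" i "Suc i"]
  by (auto simp: length_repeat_at nth_repeat_at sigma_def)

lemma delete_at_repeat_at:
  assumes "i < length \<theta>" "l = i \<or> l = Suc i" shows "delete_at l (repeat_at i \<theta>) = \<theta>"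
proof (rule nth_equalityI)
  have l: "l < length (repeat_at i \<theta>)" using assms by (auto simp: length_repeat_at)
  then show "length (delete_at l (repeat_at i \<theta>)) = length \<theta>"
    using assms by (simp add: length_delete_at length_repeat_at)
  fix j assume "j < length (delete_at l (repeat_at i \<theta>))"
  then have j: "j < length \<theta>" using assms l by (simp add: length_delete_at length_repeat_at)
  then have "delta l j \<le> length \<theta>" by (simp add: delta_def)
  moreover have "sigma i (delta l j) = j" using assms by (auto simp: sigma_def delta_def)
  ultimately show "delete_at l (repeat_at i \<theta>) ! j = \<theta> ! j"
    using assms l j by (simp add: nth_delete_at nth_repeat_at length_repeat_at)
qed

lemma repeat_at_delete_at:
  assumes "Suc a < length \<theta>" "\<theta> ! a = \<theta> ! Suc a" shows "repeat_at a (delete_at a \<theta>) = \<theta>"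
proof (rule nth_equalityI)
  have a: "a < length (delete_at a \<theta>)" using assms by (simp add: length_delete_at)
  then show "length (repeat_at a (delete_at a \<theta>)) = length \<theta>"
    using assms by (simp add: length_delete_at length_repeat_at)
  fix j assume "j < length (repeat_at a (delete_at a \<theta>))"
  then have j: "j < length \<theta>" using assms a by (simp add: length_delete_at length_repeat_at)
  then have "sigma a j < length \<theta> - 1" using assms by (auto simp: sigma_def)
  moreover have "\<theta> ! delta a (sigma a j) = \<theta> ! j"
    using assms by (cases "j = a") (auto simp: sigma_def delta_def)
  ultimately show "repeat_at a (delete_at a \<theta>) ! j = \<theta> ! j"
    using assms a j by (simp add: nth_delete_at nth_repeat_at length_delete_at)
qed

lemma not_distinct_delete_at:
  assumes "Suc a < length \<theta>" "\<theta> ! a = \<theta> ! Suc a" "l < length \<theta>" "l \<noteq> a" "l \<noteq> Suc a"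
  shows "\<not> distinct (delete_at l \<theta>)"
proof -
  have "sigma l a < length \<theta> - 1" "sigma l (Suc a) < length \<theta> - 1" "sigma l a \<noteq> sigma l (Suc a)"
    "delta l (sigma l a) = a" "delta l (sigma l (Suc a)) = Suc a"
    using assms by (auto simp: sigma_def delta_def)
  then show ?thesis
    unfolding distinct_conv_nth using assms by (metis length_delete_at nth_delete_at)
qed

lemma delete_at_eq_of_repeat:
  assumes "Suc a < length \<theta>" "\<theta> ! a = \<theta> ! Suc a" shows "delete_at (Suc a) \<theta> = delete_at a \<theta>"
proof -
  have "a < length (delete_at a \<theta>)" using assms by (simp add: length_delete_at)
  then have "delete_at (Suc a) (repeat_at a (delete_at a \<theta>)) = delete_at a \<theta>"
    by (simp add: delete_at_repeat_at)
  then show ?thesis using repeat_at_delete_at[OF assms] by simp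
qed

lemma sorted_not_distinct:
  assumes "sorted (\<theta> :: nat list)" "\<not> distinct \<theta>"
  obtains a where "Suc a < length \<theta>" "\<theta> ! a = \<theta> ! Suc a"
proof -
  have "\<not> sorted_wrt (<) \<theta>" using assms strict_sorted_iff by auto
  then obtain a where a: "Suc a < length \<theta>" "\<not> \<theta> ! a < \<theta> ! Suc a"
    using sorted_wrt_iff_nth_Suc_transp[of "(<)" \<theta>] by (auto simp: transp_def)
  then show ?thesis using that assms(1) sorted_nth_mono[of \<theta> a "Suc a"] by force
qed

lemma delete_at_upt: "i \<le> r \<Longrightarrow> delete_at i [0..<Suc r] = map (delta i) [0..<r]"
  by (rule nth_equalityI) (auto simp: length_delete_at nth_delete_at delta_def simp del: upt_Suc)

text \<open>An injective monotone map is the identity or misses a value j and then factors through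
  the j-th coface, with \<open>sigma j\<close> undoing it on the remaining values. This is the case
  split behind the inductions on cochains.\<close>

lemma monotone_map_cases:
  assumes \<theta>: "sorted \<theta>" "distinct \<theta>" "length \<theta> = Suc r" "set \<theta> \<subseteq> {..k}"
  obtains (id) "k = r" "\<theta> = [0..<Suc r]"
  | (delta) k' j \<theta>' where "k = Suc k'" "j \<le> k" "r \<le> k'" "\<theta> = map (delta j) \<theta>'" "sorted \<theta>'" "distinct \<theta>'"
      "length \<theta>' = Suc r" "set \<theta>' \<subseteq> {..k'}"
proof -
  have card: "card (set \<theta>) = Suc r" using \<theta> by (simp add: distinct_card)
  then have rk: "r \<le> k" using card_mono[OF _ \<theta>(4)] by simp
  show ?thesis
  proof (cases "k = r")
    case True
    then have "set \<theta> = {..r}" using card \<theta>(4) by (intro card_subset_eq) auto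
    moreover have "sorted_wrt (<) \<theta>" using \<theta> by (simp add: strict_sorted_iff)
    ultimately have "\<theta> = [0..<Suc r]"
      by (intro strict_sorted_equal) (auto simp: atMost_atLeast0 atLeastLessThanSuc_atLeastAtMost simp del: upt_Suc)
    then show ?thesis using id True by blast
  next
    case False
    then obtain k' where k': "k = Suc k'" "r \<le> k'" using rk by (cases k) auto
    have "set \<theta> \<noteq> {..k}" using card False by auto
    then obtain j where j: "j \<le> k" "j \<notin> set \<theta>" using \<theta>(4) by auto
    let ?\<theta> = "map (sigma j) \<theta>"
    have eq: "\<theta> = map (delta j) ?\<theta>"
      using j by (auto simp: map_idI sigma_def delta_def intro!: map_idI[symmetric])
    have "distinct ?\<theta>" using \<theta>(2) eq by (metis distinct_map)
    moreover have "sorted ?\<theta>" unfolding sorted_map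
      using \<theta>(1) by (rule sorted_wrt_mono_rel[rotated]) (auto simp: sigma_def)
    moreover have "set ?\<theta> \<subseteq> {..k'}"
    proof
      fix l assume "l \<in> set ?\<theta>"
      then obtain m where "m \<in> set \<theta>" "l = sigma j m" by auto
      moreover from this have "m \<noteq> j" "m \<le> k" using j \<theta>(4) by auto
      ultimately show "l \<in> {..k'}" using j k' by (auto simp: sigma_def)
    qed
    ultimately show ?thesis using delta[of k' j ?\<theta>] k' j eq \<theta>(3) by simp
  qed
qed

section \<open>Partial alternating products\<close>

text \<open>The solution of p_0 = e_0 and p_(j-1) p_j = e_j, that is, the coordinates of an element
  of degree N + 1 of k(A, N) whose faces 0, ..., N are the given e_j.\<close>

primrec alt_prod :: "('b, 'c) monoid_scheme \<Rightarrow> (nat \<Rightarrow> 'b) \<Rightarrow> nat \<Rightarrow> 'b" where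
  "alt_prod A e 0 = e 0"
| "alt_prod A e (Suc j) = e (Suc j) \<otimes>\<^bsub>A\<^esub> inv\<^bsub>A\<^esub> (alt_prod A e j)"

lemma alt_prod_cong: "(\<And>i. i \<le> j \<Longrightarrow> e i = e' i) \<Longrightarrow> alt_prod A e j = alt_prod A e' j"
  by (induction j) auto

context comm_group
begin

lemma alt_prod_closed [simp]: "(\<And>i. i \<le> j \<Longrightarrow> e i \<in> carrier G) \<Longrightarrow> alt_prod G e j \<in> carrier G"
  by (induction j) auto

lemma alt_prod_mult:
  "(\<And>i. i \<le> j \<Longrightarrow> e i \<in> carrier G) \<Longrightarrow> (\<And>i. i \<le> j \<Longrightarrow> e' i \<in> carrier G) \<Longrightarrow>
   alt_prod G (\<lambda>i. e i \<otimes> e' i) j = alt_prod G e j \<otimes> alt_prod G e' j"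
proof (induction j)
  case (Suc j)
  then show ?case by (simp add: inv_mult m_ac)
qed simp

text \<open>Two equal neighbouring entries cancel as soon as both have been reached, so only the
  partial product ending at the first of them sees \<open>v\<close>. This is the i-th inclusion that
  defines the degeneracies of k(A, n).\<close>

lemma alt_prod_spike:
  assumes "v \<in> carrier G" and e: "\<And>i. i \<le> j \<Longrightarrow> e i = (if i = a \<or> i = Suc a then v else \<one>)"
  shows "alt_prod G e j = (if j = a then v else \<one>)"
  using e by (induction j) (use assms(1) in auto)

lemma eq_of_consecutive_products:
  assumes v: "\<And>i. i \<le> m \<Longrightarrow> v i \<in> carrier G" "\<And>i. i \<le> m \<Longrightarrow> v' i \<in> carrier G"
    and 0: "v 0 = v' 0" and S: "\<And>i. Suc i \<le> m \<Longrightarrow> v i \<otimes> v (Suc i) = v' i \<otimes> v' (Suc i)"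
  shows "i \<le> m \<Longrightarrow> v i = v' i"
proof (induction i)
  case (Suc i)
  then show ?case using S[of i] v(1)[of i] v(1)[of "Suc i"] v(2)[of "Suc i"] by simp
qed (simp add: 0)

end

section \<open>Simplicial groups with Moore complex concentrated in one degree\<close>

text \<open>All faces out of degree \<open>Suc n\<close> end in a trivial group, so that level
  consists of cycles and serves as the coefficient group itself.\<close>

locale concentrated_simplicial_group = simplicial_group Y for Y :: "'a sgrp" +
  fixes n :: nat
  assumes low: "k \<le> n \<Longrightarrow> carrier (level Y k) = {\<one>\<^bsub>level Y k\<^esub>}"
    and comm_level: "comm_group (level Y (Suc n))"
    and high: "Suc n < k \<Longrightarrow> moore Y k \<subseteq> {\<one>\<^bsub>level Y k\<^esub>}"
begin

abbreviation N :: nat where "N \<equiv> Suc n"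
abbreviation A :: "'a monoid" where "A \<equiv> level Y (Suc n)"

sublocale A: comm_group A
  by (rule comm_level)

lemma degen_low: "k \<le> n \<Longrightarrow> i \<le> k \<Longrightarrow> x \<in> carrier (level Y k) \<Longrightarrow> degen Y k i x = \<one>\<^bsub>level Y (Suc k)\<^esub>"
  using low by auto

text \<open>The normalised \<open>N\<close>-cochain \<open>\<theta> \<mapsto> \<theta>^* x\<close> of an element of \<open>Y_k\<close>.\<close>

definition cochain :: "nat \<Rightarrow> 'a \<Rightarrow> nat list \<Rightarrow> 'a" where
  "cochain k x \<theta> = (if distinct \<theta> then face_word Y k (missing k \<theta>) x else \<one>\<^bsub>A\<^esub>)"

lemma cochain_closed:
  assumes "length \<theta> = Suc N" "set \<theta> \<subseteq> {..k}" "x \<in> carrier (level Y k)"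
  shows "cochain k x \<theta> \<in> carrier A"
proof (cases "distinct \<theta>")
  case True
  have "\<theta> \<noteq> []" using assms by auto
  then show ?thesis
    using face_word_missing_mem[of "\<lambda>k. carrier (level Y k)" \<theta> k x] assms distinct_card[OF True] True
    by (simp add: cochain_def)
qed (simp add: cochain_def)

lemma cochain_one:
  assumes "length \<theta> = Suc N" "set \<theta> \<subseteq> {..k}"
  shows "cochain k \<one>\<^bsub>level Y k\<^esub> \<theta> = \<one>\<^bsub>A\<^esub>"
proof (cases "distinct \<theta>")
  case True
  have "\<theta> \<noteq> []" using assms by auto
  then show ?thesis
    using face_word_missing_mem[of "\<lambda>k. {\<one>\<^bsub>level Y k\<^esub>}" \<theta> k "\<one>\<^bsub>level Y k\<^esub>"] assms distinct_card[OF True] True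
    by (simp add: cochain_def)
qed (simp add: cochain_def)

lemma cochain_face:
  assumes "length \<theta> = Suc N" "set \<theta> \<subseteq> {..k}" "i \<le> Suc k" "x \<in> carrier (level Y (Suc k))"
  shows "cochain k (face Y (Suc k) i x) \<theta> = cochain (Suc k) x (map (delta i) \<theta>)"
proof -
  have "\<theta> \<noteq> []" using assms by auto
  moreover have "distinct (map (delta i) \<theta>) = distinct \<theta>"
    using inj_delta[of i] by (auto simp: distinct_map inj_on_def)
  ultimately show ?thesis
    using face_word_missing_face[of \<theta> k i x] assms by (simp add: cochain_def)
qed

lemma cochain_id: "cochain N x [0..<Suc N] = x"
  by (simp add: cochain_def missing_def filter_empty_conv[THEN iffD2] del: upt_Suc)

lemma cochain_mult:
  assumes "length \<theta> = Suc N" "set \<theta> \<subseteq> {..k}" "sorted \<theta>"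
    and "x \<in> carrier (level Y k)" "y \<in> carrier (level Y k)"
  shows "cochain k (x \<otimes>\<^bsub>level Y k\<^esub> y) \<theta> = cochain k x \<theta> \<otimes>\<^bsub>A\<^esub> cochain k y \<theta>"
  using assms
proof (induction k arbitrary: x y \<theta>)
  case (0 x y \<theta>)
  show ?case
  proof (cases "distinct \<theta>")
    case True
    then show ?thesis
      using 0 monotone_map_cases[of \<theta> N 0] by (metis Zero_not_Suc)
  qed (simp add: cochain_def)
next
  case (Suc k x y \<theta>)
  show ?case
  proof (cases "distinct \<theta>")
    case True
    from Suc.prems(3) True Suc.prems(1,2) show ?thesis
    proof (cases rule: monotone_map_cases)
      case id
      then show ?thesis using cochain_id[of x] cochain_id[of y] cochain_id[of "x \<otimes>\<^bsub>level Y (Suc k)\<^esub> y"]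
        by (simp del: upt_Suc)
    next
      case (delta k' j \<theta>')
      then show ?thesis
        using Suc.IH[of \<theta>' "face Y (Suc k) j x" "face Y (Suc k) j y"] Suc.prems
        by (simp add: cochain_face[symmetric])
    qed
  qed (simp add: cochain_def)
qed

text \<open>If \<theta> repeats a value, so does its composite with the codegeneracy, and both sides
  are 1. Otherwise a coface is peeled off \<theta> and moved past the degeneracy by the identities
  for d_j s_i; in the two cases where a degeneracy survives, it acts one degree lower.\<close>

lemma cochain_degen:
  assumes "length \<theta> = Suc N" "set \<theta> \<subseteq> {..Suc k}" "sorted \<theta>" "i \<le> k" "x \<in> carrier (level Y k)"
  shows "cochain (Suc k) (degen Y k i x) \<theta> = cochain k x (map (sigma i) \<theta>)"
  using assms
proof (induction k arbitrary: x i \<theta> rule: less_induct)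
  case (less k x i \<theta>)
  have set_sigma: "set (map (sigma a) \<rho>) \<subseteq> {..m}" if "set \<rho> \<subseteq> {..Suc m}" "a \<le> m" for \<rho> m a
    using that by (auto simp: sigma_def)
  show ?case
  proof (cases "distinct \<theta>")
    case False
    then have "\<not> distinct (map (sigma i) \<theta>)" by (auto simp: distinct_map)
    then show ?thesis using False by (simp add: cochain_def)
  next
    case True
    from less.prems(3) True less.prems(1,2) show ?thesis
    proof (cases rule: monotone_map_cases)
      case id
      \<comment> \<open>For the identity list k = n, so \<open>x\<close> belongs to a trivial
        level.\<close>
      then have "x = \<one>\<^bsub>level Y k\<^esub>" using low[of k] less.prems by auto
      then show ?thesis
        using less.prems set_sigma by (simp add: cochain_one)
    next
      case (delta k' j \<theta>')
      have LHS: "cochain (Suc k) (degen Y k i x) \<theta> = cochain k (face Y (Suc k) j (degen Y k i x)) \<theta>'"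
        using delta less.prems by (simp add: cochain_face)
      consider "j = i \<or> j = Suc i" | "j < i" | "Suc i < j" by linarith
      then show ?thesis
      proof cases
        case 1
        then have "map (sigma i) \<theta> = \<theta>'"
          using delta by (auto simp: sigma_def delta_def intro!: map_idI)
        then show ?thesis using LHS 1 less.prems by auto
      next
        case 2
        then obtain k0 where k0: "k = Suc k0" using less.prems by (cases k) auto
        then have fx: "face Y k j x \<in> carrier (level Y k0)" "i - 1 \<le> k0"
          using 2 less.prems by auto
        have "cochain k (face Y (Suc k) j (degen Y k i x)) \<theta>' =
            cochain k (degen Y k0 (i - 1) (face Y k j x)) \<theta>'"
          using 2 k0 less.prems face_degen_less[of j i k0 x] by simp
        also have "\<dots> = cochain k0 (face Y k j x) (map (sigma (i - 1)) \<theta>')"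
          using less.IH[of k0 \<theta>' "i - 1" "face Y k j x"] 2 k0 less.prems delta fx by simp
        also have "\<dots> = cochain k x (map (delta j) (map (sigma (i - 1)) \<theta>'))"
          using cochain_face[of "map (sigma (i - 1)) \<theta>'" k0 j x] set_sigma[of \<theta>' k0 "i - 1"]
            2 k0 less.prems delta by simp
        also have "map (delta j) (map (sigma (i - 1)) \<theta>') = map (sigma i) \<theta>"
          using delta 2 by (auto simp: sigma_def delta_def)
        finally show ?thesis using LHS by simp
      next
        case 3
        then obtain k0 where k0: "k = Suc k0" using delta by (cases k) auto
        then have fx: "face Y k (j - 1) x \<in> carrier (level Y k0)" "i \<le> k0"
          using 3 delta less.prems by auto
        have "cochain k (face Y (Suc k) j (degen Y k i x)) \<theta>' =
            cochain k (degen Y k0 i (face Y k (j - 1) x)) \<theta>'"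
          using 3 k0 less.prems delta face_degen_greater[of i j k0 x] by simp
        also have "\<dots> = cochain k0 (face Y k (j - 1) x) (map (sigma i) \<theta>')"
          using less.IH[of k0 \<theta>' i "face Y k (j - 1) x"] 3 k0 less.prems delta fx by simp
        also have "\<dots> = cochain k x (map (delta (j - 1)) (map (sigma i) \<theta>'))"
          using cochain_face[of "map (sigma i) \<theta>'" k0 "j - 1" x] set_sigma[of \<theta>' k0 i]
            3 k0 less.prems delta by simp
        also have "map (delta (j - 1)) (map (sigma i) \<theta>') = map (sigma i) \<theta>"
          using delta 3 by (auto simp: sigma_def delta_def)
        finally show ?thesis using LHS by simp
      qed
    qed
  qed
qed

text \<open>Subtracting the degenerate elements \<open>s_r p_r\<close> one by one leaves an element of the Moore complex
  in degree \<open>N + 1\<close>, which is trivial; its last face is the alternating product of all faces.\<close>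

lemma faces_alternating:
  assumes x: "x \<in> carrier (level Y (Suc N))"
  shows "alt_prod A (\<lambda>i. face Y (Suc N) i x) N = face Y (Suc N) (Suc N) x"
proof -
  let ?P = "alt_prod A (\<lambda>i. face Y (Suc N) i x)" and ?G = "level Y (Suc N)"
  have P: "?P r \<in> carrier A" if "r \<le> N" for r
    using that x by (intro A.alt_prod_closed) simp
  \<comment> \<open>Invariant after r corrections: faces below r are gone, faces above r are those
    of \<open>x\<close>, and face r is the partial product \<open>?P r\<close>, written out because
    the recursion has no predecessor at 0.\<close>
  have "\<exists>w\<in>carrier ?G. (\<forall>i<r. face Y (Suc N) i w = \<one>\<^bsub>A\<^esub>) \<and>
     (\<forall>i. r < i \<and> i \<le> Suc N \<longrightarrow> face Y (Suc N) i w = face Y (Suc N) i x) \<and>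
     face Y (Suc N) r w = (if r = 0 then face Y (Suc N) 0 x
        else face Y (Suc N) r x \<otimes>\<^bsub>A\<^esub> inv\<^bsub>A\<^esub> (?P (r - 1)))" if "r \<le> Suc N" for r
    using that
  proof (induction r)
    case 0
    then show ?case using x by auto
  next
    case (Suc r)
    then obtain w where w: "w \<in> carrier ?G" "\<forall>i<r. face Y (Suc N) i w = \<one>\<^bsub>A\<^esub>"
      "\<forall>i. r < i \<and> i \<le> Suc N \<longrightarrow> face Y (Suc N) i w = face Y (Suc N) i x"
      and wr: "face Y (Suc N) r w = (if r = 0 then face Y (Suc N) 0 x
        else face Y (Suc N) r x \<otimes>\<^bsub>A\<^esub> inv\<^bsub>A\<^esub> (?P (r - 1)))" by auto
    have r: "r \<le> N" using Suc.prems by simp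
    have wP: "face Y (Suc N) r w = ?P r" using wr by (cases r) auto
    let ?s = "degen Y N r (inv\<^bsub>A\<^esub> (?P r))"
    have s: "?s \<in> carrier ?G" using P[OF r] r by simp
    \<comment> \<open>Apart from faces r and r + 1, the faces of \<open>?s\<close> are degeneracies
      of elements of the trivial level n.\<close>
    have far: "face Y (Suc N) i ?s = \<one>\<^bsub>A\<^esub>" if "i < r \<or> Suc r < i" "i \<le> Suc N" for i
    proof -
      have c: "face Y N a (inv\<^bsub>A\<^esub> (?P r)) \<in> carrier (level Y n)" if "a \<le> N" for a
        using P[OF r] that by simp
      show ?thesis
        using that r P[OF r] degen_low[OF order_refl, of "r - 1", OF _ c[of i]]
          degen_low[OF order_refl, of r, OF _ c[of "i - 1"]]
        by (auto simp: face_degen_less face_degen_greater)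
    qed
    have "face Y (Suc N) i (w \<otimes>\<^bsub>?G\<^esub> ?s) = face Y (Suc N) i w \<otimes>\<^bsub>A\<^esub> face Y (Suc N) i ?s"
      if "i \<le> Suc N" for i using that w s by simp
    moreover have "face Y (Suc N) i ?s = inv\<^bsub>A\<^esub> (?P r)" if "i = r \<or> i = Suc r" for i
      using that r P[OF r] by auto
    ultimately show ?case
      using w wP far r x P[OF r] s
      by (intro bexI[of _ "w \<otimes>\<^bsub>?G\<^esub> ?s"]) (auto simp: less_Suc_eq)
  qed
  from this[of "Suc N"] obtain w where w: "w \<in> carrier ?G" "\<forall>i<Suc N. face Y (Suc N) i w = \<one>\<^bsub>A\<^esub>"
    "face Y (Suc N) (Suc N) w = face Y (Suc N) (Suc N) x \<otimes>\<^bsub>A\<^esub> inv\<^bsub>A\<^esub> (?P N)" by auto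
  then have "w \<in> moore Y (Suc N)" by (simp add: mem_moore_Suc)
  then have "w = \<one>\<^bsub>?G\<^esub>" using high[of "Suc N"] by auto
  then have "face Y (Suc N) (Suc N) x \<otimes>\<^bsub>A\<^esub> inv\<^bsub>A\<^esub> (?P N) = \<one>\<^bsub>A\<^esub>" using w by simp
  then show ?thesis using P[of N] x lev.inv_solve_right'[of "\<one>\<^bsub>A\<^esub>" N "face Y (Suc N) (Suc N) x" "?P N"] by simp
qed

text \<open>Deleting either of two equal neighbours gives the same list, while deleting any other
  entry leaves a repetition, on which the cochain is 1. This is the pattern required by
  \<open>alt_prod_spike\<close>.\<close>

lemma cochain_spike:
  assumes "Suc a < length \<tau>" "\<tau> ! a = \<tau> ! Suc a" "i < length \<tau>"
  shows "cochain k x (delete_at i \<tau>) =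
    (if i = a \<or> i = Suc a then cochain k x (delete_at a \<tau>) else \<one>\<^bsub>A\<^esub>)"
  using not_distinct_delete_at[OF assms(1,2), of i] delete_at_eq_of_repeat[OF assms(1,2)] assms(3)
  by (auto simp: cochain_def)

text \<open>Peeling cofaces off an injective \<tau> replaces \<open>x\<close> by its faces until
  \<tau> is the identity of [N + 1]; then the entries are the faces of \<open>x\<close>, and
  \<open>faces_alternating\<close> applies.\<close>

lemma cocycle:
  assumes "length \<tau> = Suc (Suc N)" "set \<tau> \<subseteq> {..k}" "sorted \<tau>" "x \<in> carrier (level Y k)"
  shows "alt_prod A (\<lambda>i. cochain k x (delete_at i \<tau>)) N = cochain k x (delete_at (Suc N) \<tau>)"
  using assms
proof (induction k arbitrary: x \<tau> rule: less_induct)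
  case (less k x \<tau>)
  show ?case
  proof (cases "distinct \<tau>")
    case False
    obtain a where a: "Suc a < length \<tau>" "\<tau> ! a = \<tau> ! Suc a"
      using sorted_not_distinct[OF less.prems(3) False] .
    let ?v = "cochain k x (delete_at a \<tau>)"
    have "?v \<in> carrier A"
      using less.prems a set_delete_at[of a \<tau>]
      by (intro cochain_closed) (auto simp: length_delete_at)
    \<comment> \<open>A pair at a < N cancels within the product; the pair (N, N + 1) is cut in
      half, leaving \<open>?v\<close>, which is also the value on the other side.\<close>
    then have "alt_prod A (\<lambda>i. cochain k x (delete_at i \<tau>)) N = (if N = a then ?v else \<one>\<^bsub>A\<^esub>)"
      using cochain_spike[OF a] less.prems by (intro A.alt_prod_spike) auto
    moreover have "cochain k x (delete_at (Suc N) \<tau>) = (if N = a then ?v else \<one>\<^bsub>A\<^esub>)"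
      using cochain_spike[OF a, of "Suc N"] a less.prems by auto
    ultimately show ?thesis by simp
  next
    case True
    from less.prems(3) True less.prems(1,2) show ?thesis
    proof (cases rule: monotone_map_cases)
      case id
      have "cochain k x (delete_at i \<tau>) = face Y (Suc N) i x" if "i \<le> Suc N" for i
        using that id less.prems atLeastLessThanSuc_atLeastAtMost[of 0 N] cochain_face[of "[0..<Suc N]" N i x] cochain_id[of "face Y (Suc N) i x"]
        by (simp add: delete_at_upt del: upt_Suc)
      note eq = this
      have "alt_prod A (\<lambda>i. cochain k x (delete_at i \<tau>)) N = alt_prod A (\<lambda>i. face Y (Suc N) i x) N"
        by (rule alt_prod_cong) (use eq in simp)
      also have "\<dots> = cochain k x (delete_at (Suc N) \<tau>)"
        using faces_alternating[of x] less.prems id eq[of "Suc N"] by (simp only:)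
      finally show ?thesis .
    next
      case (delta k' j \<tau>')
      have "cochain k x (delete_at i \<tau>) = cochain k' (face Y k j x) (delete_at i \<tau>')" if "i \<le> Suc N" for i
        using cochain_face[of "delete_at i \<tau>'" k' j x] that delta less.prems set_delete_at[of i \<tau>']
        by (auto simp: delete_at_map length_delete_at)
      note eq = this
      have "alt_prod A (\<lambda>i. cochain k x (delete_at i \<tau>)) N =
          alt_prod A (\<lambda>i. cochain k' (face Y k j x) (delete_at i \<tau>')) N"
        by (rule alt_prod_cong) (use eq in simp)
      also have "\<dots> = cochain k' (face Y k j x) (delete_at (Suc N) \<tau>')"
        using less.IH[of k' \<tau>' "face Y k j x"] delta less.prems by simp
      also have "\<dots> = cochain k x (delete_at (Suc N) \<tau>)"
        using eq[of "Suc N"] by simp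
      finally show ?thesis .
    qed
  qed
qed

text \<open>Equal cochains give equal cochains of all faces, so by induction \<open>x\<close> and
  \<open>y\<close> have the same faces. Their quotient then lies in the Moore complex, which is
  trivial above N; in degree N the cochain on the identity is the element itself.\<close>

lemma cochain_inj:
  assumes "x \<in> carrier (level Y k)" "y \<in> carrier (level Y k)"
    and "\<And>\<theta>. length \<theta> = Suc N \<Longrightarrow> set \<theta> \<subseteq> {..k} \<Longrightarrow> sorted \<theta> \<Longrightarrow> distinct \<theta> \<Longrightarrow> cochain k x \<theta> = cochain k y \<theta>"
  shows "x = y"
  using assms
proof (induction k arbitrary: x y)
  case (0 x y)
  then show ?case using low[of 0] by auto
next
  case (Suc k x y)
  consider "Suc k \<le> n" | "Suc k = N" | "N < Suc k" by linarith
  then show ?case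
  proof cases
    case 1
    then show ?thesis using low[of "Suc k"] Suc.prems by auto
  next
    case 2
    then have "cochain (Suc k) x [0..<Suc N] = cochain (Suc k) y [0..<Suc N]"
      by (intro Suc.prems(3)) (auto simp del: upt_Suc)
    then show ?thesis using cochain_id 2 by (simp del: upt_Suc)
  next
    case 3
    have "face Y (Suc k) i x = face Y (Suc k) i y" if i: "i \<le> Suc k" for i
    proof (rule Suc.IH)
      fix \<theta> assume \<theta>: "length \<theta> = Suc N" "set \<theta> \<subseteq> {..k}" "sorted \<theta>" "distinct \<theta>"
      have "set (map (delta i) \<theta>) \<subseteq> {..Suc k}" using \<theta> by (auto simp: delta_def)
      moreover have "distinct (map (delta i) \<theta>)"
        using \<theta> inj_delta[of i] by (auto simp: distinct_map inj_on_def)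
      ultimately have "cochain (Suc k) x (map (delta i) \<theta>) = cochain (Suc k) y (map (delta i) \<theta>)"
        using \<theta> by (intro Suc.prems(3)) (auto simp: sorted_map_delta)
      then show "cochain k (face Y (Suc k) i x) \<theta> = cochain k (face Y (Suc k) i y) \<theta>"
        using \<theta> i Suc.prems by (simp add: cochain_face)
    qed (use i Suc.prems in auto)
    then have "x \<otimes>\<^bsub>level Y (Suc k)\<^esub> inv\<^bsub>level Y (Suc k)\<^esub> y \<in> moore Y (Suc k)"
      using Suc.prems by (simp add: mem_moore_Suc)
    then have "x \<otimes>\<^bsub>level Y (Suc k)\<^esub> inv\<^bsub>level Y (Suc k)\<^esub> y = \<one>\<^bsub>level Y (Suc k)\<^esub>"
      using high[OF 3] by auto
    then show ?thesis using Suc.prems lev.inv_solve_right'[of "\<one>\<^bsub>level Y (Suc k)\<^esub>" "Suc k" x y] by simp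
  qed
qed

end

section \<open>Index lists and faces of a coskeleton\<close>

lemma monotone_maps_length_cases:
  assumes "\<theta> \<in> monotone_maps (Suc m) k"
  obtains "length \<theta> \<le> m" | "length \<theta> = Suc m" | "length \<theta> = Suc (Suc m)"
proof -
  have "length \<theta> \<le> Suc (Suc m)" using assms by (simp add: monotone_maps_def)
  then have "length \<theta> \<le> m \<or> length \<theta> = Suc m \<or> length \<theta> = Suc (Suc m)" by linarith
  then show thesis using that by blast
qed

lemma monotone_maps_delete_at:
  "\<theta> \<in> monotone_maps m k \<Longrightarrow> i < length \<theta> \<Longrightarrow> 2 \<le> length \<theta> \<Longrightarrow> delete_at i \<theta> \<in> monotone_maps m k"
  using set_delete_at[of i \<theta>] length_delete_at[of i \<theta>] sorted_delete_at[of \<theta> i]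
  by (auto simp: monotone_maps_def)

lemma monotone_maps_repeat_at:
  "\<theta> \<in> monotone_maps m k \<Longrightarrow> i < length \<theta> \<Longrightarrow> length \<theta> \<le> m \<Longrightarrow> repeat_at i \<theta> \<in> monotone_maps m k"
  using set_repeat_at[of i \<theta>] length_repeat_at[of i \<theta>] sorted_repeat_at[of \<theta> i]
  by (auto simp: monotone_maps_def)

lemma monotone_maps_delta:
  "\<theta> \<in> monotone_maps m k \<Longrightarrow> i \<le> Suc k \<Longrightarrow> map (delta i) \<theta> \<in> monotone_maps m (Suc k)"
  by (auto simp: monotone_maps_def sorted_map_delta) (auto simp: delta_def)

lemma sorted_map_sigma: "sorted \<theta> \<Longrightarrow> sorted (map (sigma i) \<theta>)"
  unfolding sorted_map by (erule sorted_wrt_mono_rel[rotated]) (auto simp: sigma_def)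

lemma monotone_maps_sigma:
  "\<theta> \<in> monotone_maps m (Suc k) \<Longrightarrow> i \<le> k \<Longrightarrow> map (sigma i) \<theta> \<in> monotone_maps m k"
  by (auto simp: monotone_maps_def sorted_map_sigma) (auto simp: sigma_def)

lemma level_em_trunc: "level (em_trunc A m) r = product_group {..<em_rank m r} (\<lambda>_. A)"
  by (simp add: em_trunc_def)

lemma face_cosk: "face (cosk m T) (Suc k) i y = (\<lambda>\<theta>\<in>monotone_maps m k. y (map (delta i) \<theta>))"
  by (simp add: cosk_def)

lemma carrier_cosk:
  "carrier (level (cosk m T) k) = {x \<in> (\<Pi>\<^sub>E \<theta>\<in>monotone_maps m k. carrier (level T (length \<theta> - 1))).
          (\<forall>\<theta>\<in>monotone_maps m k. \<forall>i<length \<theta>. 2 \<le> length \<theta> \<longrightarrow>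
              face T (length \<theta> - 1) i (x \<theta>) = x (delete_at i \<theta>)) \<and>
          (\<forall>\<theta>\<in>monotone_maps m k. \<forall>i<length \<theta>. length \<theta> \<le> m \<longrightarrow>
              degen T (length \<theta> - 1) i (x \<theta>) = x (repeat_at i \<theta>))}"
  by (simp add: cosk_def cosk_level_def)

lemma mult_cosk:
  "x \<otimes>\<^bsub>level (cosk m T) k\<^esub> y = (\<lambda>\<theta>\<in>monotone_maps m k. x \<theta> \<otimes>\<^bsub>level T (length \<theta> - 1)\<^esub> y \<theta>)"
  by (simp add: cosk_def cosk_level_def)

lemma face_cosk_closed:
  assumes y: "y \<in> carrier (level (cosk m T) (Suc k))" and i: "i \<le> Suc k"
  shows "face (cosk m T) (Suc k) i y \<in> carrier (level (cosk m T) k)"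
proof -
  have "y (map (delta i) \<theta>) \<in> carrier (level T (length \<theta> - 1))" if "\<theta> \<in> monotone_maps m k" for \<theta>
  proof -
    have "map (delta i) \<theta> \<in> monotone_maps m (Suc k)" using that i by (rule monotone_maps_delta)
    then show ?thesis using y by (fastforce simp: carrier_cosk PiE_iff)
  qed
  moreover have "face T (length \<theta> - 1) a (y (map (delta i) \<theta>)) = y (map (delta i) (delete_at a \<theta>))"
    if "\<theta> \<in> monotone_maps m k" "a < length \<theta>" "2 \<le> length \<theta>" for \<theta> a
    using y monotone_maps_delta[OF that(1) i] that
    by (auto simp: carrier_cosk delete_at_map[symmetric])
  moreover have "degen T (length \<theta> - 1) a (y (map (delta i) \<theta>)) = y (map (delta i) (repeat_at a \<theta>))"
    if "\<theta> \<in> monotone_maps m k" "a < length \<theta>" "length \<theta> \<le> m" for \<theta> a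
    using y monotone_maps_delta[OF that(1) i] that
    by (auto simp: carrier_cosk repeat_at_map[symmetric])
  ultimately show ?thesis
    by (auto simp: carrier_cosk face_cosk monotone_maps_delete_at monotone_maps_repeat_at)
qed

text \<open>Needed for surjectivity, where the faces of an element of the coskeleton have to form a
  compatible horn.\<close>

lemma face_face_cosk:
  assumes "i < j" "j \<le> Suc (Suc k)"
  shows "face (cosk m T) (Suc k) i (face (cosk m T) (Suc (Suc k)) j y) =
    face (cosk m T) (Suc k) (j - 1) (face (cosk m T) (Suc (Suc k)) i y)"
proof -
  have "map (delta j) (map (delta i) \<theta>) = map (delta i) (map (delta (j - 1)) \<theta>)" for \<theta>
    using assms by (auto simp: delta_def)
  then show ?thesis
    using assms by (auto simp: face_cosk monotone_maps_delta simp del: map_map)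
qed

section \<open>The comparison with the Eilenberg-Mac Lane simplicial group\<close>

context concentrated_simplicial_group
begin

abbreviation E :: "(nat list \<Rightarrow> nat \<Rightarrow> 'a) sgrp" where "E \<equiv> eilenberg_mac_lane A N"

text \<open>The element of \<open>k(A,N)\<close> with the prescribed faces: in degree \<open>N + 1\<close> the equations
  \<open>d_i p = p_(i-1) p_i\<close> determine the coordinates of \<open>p\<close>.\<close>

definition em_vec :: "(nat list \<Rightarrow> 'a) \<Rightarrow> nat list \<Rightarrow> nat \<Rightarrow> 'a" where
  "em_vec c \<theta> = (\<lambda>j\<in>{..<em_rank N (length \<theta> - 1)}.
     if length \<theta> = Suc N then c \<theta> else alt_prod A (\<lambda>i. c (delete_at i \<theta>)) j)"

definition em_map :: "nat \<Rightarrow> 'a \<Rightarrow> nat list \<Rightarrow> nat \<Rightarrow> 'a" where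
  "em_map k x = (\<lambda>\<theta>\<in>monotone_maps (Suc N) k. em_vec (cochain k x) \<theta>)"

text \<open>Reindexing along an arbitrary \<open>g\<close> covers the cofaces and the codegeneracies
  at once; it works because deletion of an entry commutes with \<open>map\<close>.\<close>

lemma em_vec_cong:
  assumes \<theta>: "\<theta> \<in> monotone_maps (Suc N) k"
    and c: "\<And>\<rho>. \<rho> \<in> monotone_maps (Suc N) k \<Longrightarrow> length \<rho> = Suc N \<Longrightarrow> c \<rho> = c' (map g \<rho>)"
  shows "em_vec c \<theta> = em_vec c' (map g \<theta>)"
  using \<theta>
proof (cases rule: monotone_maps_length_cases)
  case 1
  then have "length \<theta> - 1 < N" by simp
  then show ?thesis by (simp add: em_vec_def em_rank_def restrict_def)
next
  case 2
  then show ?thesis using c[OF \<theta>] by (simp add: em_vec_def)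
next
  case 3
  have "c (delete_at i \<theta>) = c' (delete_at i (map g \<theta>))" if "i \<le> N" for i
    using that 3 c[of "delete_at i \<theta>"] monotone_maps_delete_at[OF \<theta>, of i]
    by (simp add: length_delete_at delete_at_map)
  then have "alt_prod A (\<lambda>i. c (delete_at i \<theta>)) j = alt_prod A (\<lambda>i. c' (delete_at i (map g \<theta>))) j"
    if "j \<le> N" for j
    using that by (intro alt_prod_cong) simp
  then show ?thesis
    unfolding em_vec_def length_map 3 by (intro restrict_ext) (simp add: em_rank_def)
qed

lemma em_map_face:
  assumes "i \<le> Suc k" "x \<in> carrier (level Y (Suc k))"
  shows "em_map k (face Y (Suc k) i x) = face E (Suc k) i (em_map (Suc k) x)"
proof
  fix \<theta>
  show "em_map k (face Y (Suc k) i x) \<theta> = face E (Suc k) i (em_map (Suc k) x) \<theta>"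
  proof (cases "\<theta> \<in> monotone_maps (Suc N) k")
    case True
    have "em_vec (cochain k (face Y (Suc k) i x)) \<theta> = em_vec (cochain (Suc k) x) (map (delta i) \<theta>)"
      by (rule em_vec_cong[OF True]) (use assms in \<open>auto simp: monotone_maps_def cochain_face\<close>)
    then show ?thesis
      using True assms by (simp add: em_map_def eilenberg_mac_lane_def face_cosk monotone_maps_delta)
  qed (simp add: em_map_def eilenberg_mac_lane_def face_cosk)
qed

lemma em_map_degen:
  assumes "i \<le> k" "x \<in> carrier (level Y k)"
  shows "em_map (Suc k) (degen Y k i x) = degen E k i (em_map k x)"
proof
  fix \<theta>
  show "em_map (Suc k) (degen Y k i x) \<theta> = degen E k i (em_map k x) \<theta>"
  proof (cases "\<theta> \<in> monotone_maps (Suc N) (Suc k)")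
    case True
    have "em_vec (cochain (Suc k) (degen Y k i x)) \<theta> = em_vec (cochain k x) (map (sigma i) \<theta>)"
      by (rule em_vec_cong[OF True]) (use assms in \<open>auto simp: monotone_maps_def cochain_degen\<close>)
    then show ?thesis
      using True assms by (simp add: em_map_def eilenberg_mac_lane_def cosk_def monotone_maps_sigma)
  qed (simp add: em_map_def eilenberg_mac_lane_def cosk_def)
qed

lemma cochain_delete_at_closed:
  assumes "\<theta> \<in> monotone_maps (Suc N) k" "length \<theta> = Suc (Suc N)" "i \<le> Suc N" "x \<in> carrier (level Y k)"
  shows "cochain k x (delete_at i \<theta>) \<in> carrier A"
  using assms monotone_maps_delete_at[of \<theta> "Suc N" k i]
  by (intro cochain_closed) (auto simp: length_delete_at monotone_maps_def)

lemma em_vec_closed: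
  assumes "\<theta> \<in> monotone_maps (Suc N) k" "x \<in> carrier (level Y k)"
  shows "em_vec (cochain k x) \<theta> \<in> carrier (level (em_trunc A N) (length \<theta> - 1))"
proof -
  from assms(1) show ?thesis
  proof (cases rule: monotone_maps_length_cases)
    case 1
    then have "length \<theta> - 1 < N" by simp
    then show ?thesis by (simp add: em_vec_def level_em_trunc em_rank_def restrict_def)
  next
    case 2
    then have "cochain k x \<theta> \<in> carrier A"
      using assms by (intro cochain_closed) (auto simp: monotone_maps_def)
    then show ?thesis using 2 by (simp add: em_vec_def level_em_trunc)
  next
    case 3
    then show ?thesis
      using cochain_delete_at_closed[OF assms(1) 3 _ assms(2)]
      by (auto simp: em_vec_def level_em_trunc em_rank_def intro!: A.alt_prod_closed)
  qed
qed

lemma face_em_trunc_low: "r \<le> N \<Longrightarrow> face (em_trunc A N) r i v = (\<lambda>_\<in>{}. undefined)"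
  by (auto simp: em_trunc_def em_rank_def restrict_def)

lemma face_em_trunc_top:
  "face (em_trunc A N) (Suc N) i v = (\<lambda>j\<in>{..<1::nat}.
     if i = 0 then v 0 else if i = Suc N then v N else v (i - 1) \<otimes>\<^bsub>A\<^esub> v i)"
  by (auto simp: em_trunc_def em_rank_def restrict_def)

text \<open>Faces 0 to N hold by the recursion of \<open>alt_prod\<close>, and face N + 1 is the
  cocycle identity. For shorter lists the target is an empty power of \<open>A\<close>.\<close>

lemma em_vec_face:
  assumes \<theta>: "\<theta> \<in> monotone_maps (Suc N) k" "i < length \<theta>" "2 \<le> length \<theta>" and x: "x \<in> carrier (level Y k)"
  shows "face (em_trunc A N) (length \<theta> - 1) i (em_vec (cochain k x) \<theta>) = em_vec (cochain k x) (delete_at i \<theta>)"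
proof (cases "length \<theta> = Suc (Suc N)")
  case False
  then have "length \<theta> - 1 \<le> N" "length \<theta> - Suc (Suc 0) < N" using \<theta> by (auto simp: monotone_maps_def)
  then show ?thesis
    using \<theta> by (simp add: face_em_trunc_low em_vec_def length_delete_at em_rank_def restrict_def)
next
  case True
  let ?e = "\<lambda>i. cochain k x (delete_at i \<theta>)"
  have e: "?e i \<in> carrier A" if "i \<le> Suc N" for i
    using cochain_delete_at_closed[OF \<theta>(1) True that x] .
  have P: "alt_prod A ?e j \<in> carrier A" if "j \<le> N" for j
    using that e by (intro A.alt_prod_closed) simp
  have "(if i = 0 then alt_prod A ?e 0 else if i = Suc N then alt_prod A ?e N
      else alt_prod A ?e (i - 1) \<otimes>\<^bsub>A\<^esub> alt_prod A ?e i) = ?e i"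
  proof -
    consider "i = 0" | "i = Suc N" | j where "i = Suc j" "i \<le> N"
    proof -
      have "i = 0 \<or> i = Suc N \<or> (\<exists>j. i = Suc j \<and> i \<le> N)"
        using \<theta>(2) True by presburger
      then show ?thesis using that by blast
    qed
    then show ?thesis
    proof cases
      case 2
      then show ?thesis using cocycle[of \<theta> k x] True \<theta> x by (simp add: monotone_maps_def del: alt_prod.simps)
    next
      case 3
      then have "alt_prod A ?e j \<otimes>\<^bsub>A\<^esub> (?e i \<otimes>\<^bsub>A\<^esub> inv\<^bsub>A\<^esub> alt_prod A ?e j) = ?e i"
        using P[of j] e[of i] by (simp add: A.m_lcomm)
      then show ?thesis using 3 by simp
    qed simp
  qed
  moreover have "i \<le> Suc N" using \<theta>(2) True by simp
  ultimately show ?thesis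
    using True \<theta> unfolding em_vec_def
    by (auto simp: face_em_trunc_top em_rank_def length_delete_at fun_eq_iff restrict_def simp del: alt_prod.simps)
qed

text \<open>Into degree N both sides are 1, as the repeated list is not injective. Into degree N + 1
  the cochain has two equal neighbouring entries, and their alternating products give the i-th
  inclusion.\<close>

lemma em_vec_degen:
  assumes \<theta>: "\<theta> \<in> monotone_maps (Suc N) k" "i < length \<theta>" "length \<theta> \<le> Suc N" and x: "x \<in> carrier (level Y k)"
  shows "degen (em_trunc A N) (length \<theta> - 1) i (em_vec (cochain k x) \<theta>) = em_vec (cochain k x) (repeat_at i \<theta>)"
proof -
  have len: "length (repeat_at i \<theta>) = Suc (length \<theta>)" using \<theta> by (simp add: length_repeat_at)
  have pos: "Suc (length \<theta> - 1) = length \<theta>" using \<theta> by simp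
  consider "length \<theta> < N" | "length \<theta> = N" | "length \<theta> = Suc N" using \<theta> by linarith
  then show ?thesis
  proof cases
    case 1
    then show ?thesis using len pos by (simp add: em_trunc_def em_vec_def em_rank_def restrict_def)
  next
    case 2
    have "cochain k x (repeat_at i \<theta>) = \<one>\<^bsub>A\<^esub>"
      using not_distinct_repeat_at[OF \<theta>(2)] by (simp add: cochain_def)
    then show ?thesis using 2 len pos
      by (auto simp: em_trunc_def em_vec_def em_rank_def restrict_def fun_eq_iff)
  next
    case 3
    have "cochain k x \<theta> \<in> carrier A"
      using 3 \<theta> x by (intro cochain_closed) (auto simp: monotone_maps_def)
    moreover have "cochain k x (delete_at l (repeat_at i \<theta>)) = (if l = i \<or> l = Suc i then cochain k x \<theta> else \<one>\<^bsub>A\<^esub>)"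
      if "l \<le> N" for l
      using cochain_spike[of i "repeat_at i \<theta>" l k x] that \<theta> 3 len
        delete_at_repeat_at[OF \<theta>(2), of i]
      by (simp add: nth_repeat_at sigma_def)
    ultimately have "alt_prod A (\<lambda>l. cochain k x (delete_at l (repeat_at i \<theta>))) j =
        (if j = i then cochain k x \<theta> else \<one>\<^bsub>A\<^esub>)" if "j \<le> N" for j
      using that by (intro A.alt_prod_spike) auto
    then show ?thesis using 3 len pos
      by (auto simp: em_trunc_def em_vec_def em_rank_def restrict_def fun_eq_iff simp del: alt_prod.simps)
  qed
qed

lemma em_map_closed:
  assumes "x \<in> carrier (level Y k)" shows "em_map k x \<in> carrier (level E k)"
  using assms em_vec_closed em_vec_face em_vec_degen
  by (auto simp: eilenberg_mac_lane_def carrier_cosk em_map_def monotone_maps_delete_at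
      monotone_maps_repeat_at)

lemma em_map_mult:
  assumes x: "x \<in> carrier (level Y k)" and y: "y \<in> carrier (level Y k)"
  shows "em_map k (x \<otimes>\<^bsub>level Y k\<^esub> y) = em_map k x \<otimes>\<^bsub>level E k\<^esub> em_map k y"
proof -
  have "em_vec (cochain k (x \<otimes>\<^bsub>level Y k\<^esub> y)) \<theta> =
      em_vec (cochain k x) \<theta> \<otimes>\<^bsub>level (em_trunc A N) (length \<theta> - 1)\<^esub> em_vec (cochain k y) \<theta>"
    if \<theta>: "\<theta> \<in> monotone_maps (Suc N) k" for \<theta>
  proof -
    from \<theta> show ?thesis
    proof (cases rule: monotone_maps_length_cases)
      case 1
      then have "length \<theta> - 1 < N" by simp
      then show ?thesis by (simp add: em_vec_def level_em_trunc em_rank_def restrict_def)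
    next
      case 2
      then show ?thesis using \<theta> x y
        by (auto simp: em_vec_def level_em_trunc em_rank_def monotone_maps_def cochain_mult restrict_def fun_eq_iff)
    next
      case 3
      have "cochain k (x \<otimes>\<^bsub>level Y k\<^esub> y) (delete_at i \<theta>) =
          cochain k x (delete_at i \<theta>) \<otimes>\<^bsub>A\<^esub> cochain k y (delete_at i \<theta>)" if "i \<le> Suc N" for i
        using monotone_maps_delete_at[OF \<theta>, of i] 3 that x y
        by (intro cochain_mult) (auto simp: monotone_maps_def length_delete_at)
      then have "alt_prod A (\<lambda>i. cochain k (x \<otimes>\<^bsub>level Y k\<^esub> y) (delete_at i \<theta>)) j =
         alt_prod A (\<lambda>i. cochain k x (delete_at i \<theta>) \<otimes>\<^bsub>A\<^esub> cochain k y (delete_at i \<theta>)) j" if "j \<le> N" for j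
        using that by (intro alt_prod_cong) simp
      also have "\<dots> j = alt_prod A (\<lambda>i. cochain k x (delete_at i \<theta>)) j \<otimes>\<^bsub>A\<^esub> alt_prod A (\<lambda>i. cochain k y (delete_at i \<theta>)) j"
        if "j \<le> N" for j
        using that cochain_delete_at_closed[OF \<theta> 3] x y by (intro A.alt_prod_mult) auto
      finally have "alt_prod A (\<lambda>i. cochain k (x \<otimes>\<^bsub>level Y k\<^esub> y) (delete_at i \<theta>)) j =
          alt_prod A (\<lambda>i. cochain k x (delete_at i \<theta>)) j \<otimes>\<^bsub>A\<^esub> alt_prod A (\<lambda>i. cochain k y (delete_at i \<theta>)) j"
        if "j \<le> N" for j using that by simp
      then show ?thesis unfolding em_vec_def level_em_trunc 3 mult_product_group
        by (intro restrict_ext) (simp add: em_rank_def)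
    qed
  qed
  then show ?thesis
    by (auto simp: em_map_def eilenberg_mac_lane_def mult_cosk restrict_def fun_eq_iff)
qed

lemma em_map_inj:
  assumes "x \<in> carrier (level Y k)" "y \<in> carrier (level Y k)" "em_map k x = em_map k y"
  shows "x = y"
proof (rule cochain_inj[OF assms(1,2)])
  fix \<theta> assume \<theta>: "length \<theta> = Suc N" "set \<theta> \<subseteq> {..k}" "sorted \<theta>"
  then have "\<theta> \<in> monotone_maps (Suc N) k" by (auto simp: monotone_maps_def)
  then have "em_vec (cochain k x) \<theta> 0 = em_vec (cochain k y) \<theta> 0"
    using fun_cong[OF assms(3), of \<theta>] by (simp add: em_map_def)
  then show "cochain k x \<theta> = cochain k y \<theta>" using \<theta> by (simp add: em_vec_def em_rank_def)
qed

text \<open>The first coordinate and the products of neighbours determine all coordinates by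
  cancellation. Face N + 1 can therefore be recovered from the others, as needed for horns without
  their last face.\<close>

lemma em_trunc_top_eqI:
  assumes v: "v \<in> (\<Pi>\<^sub>E j\<in>{..<Suc N}. carrier A)" "v' \<in> (\<Pi>\<^sub>E j\<in>{..<Suc N}. carrier A)"
    and f: "\<And>i. i \<le> N \<Longrightarrow> face (em_trunc A N) (Suc N) i v = face (em_trunc A N) (Suc N) i v'"
  shows "v = v'"
proof (rule PiE_ext[OF v])
  fix j assume "j \<in> {..<Suc N}"
  then have j: "j \<le> N" by simp
  have "v 0 = v' 0"
    using fun_cong[OF f[of 0], of 0] by (simp add: face_em_trunc_top)
  moreover have "v i \<otimes>\<^bsub>A\<^esub> v (Suc i) = v' i \<otimes>\<^bsub>A\<^esub> v' (Suc i)" if "Suc i \<le> N" for i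
    using fun_cong[OF f[of "Suc i"], of 0] that by (simp add: face_em_trunc_top)
  ultimately show "v j = v' j"
    using v j by (intro A.eq_of_consecutive_products[of N v v' j]) (auto simp: PiE_iff)
qed

lemma E_PiE:
  "y \<in> carrier (level E k) \<Longrightarrow>
   y \<in> (\<Pi>\<^sub>E \<theta>\<in>monotone_maps (Suc N) k. \<Pi>\<^sub>E j\<in>{..<em_rank N (length \<theta> - 1)}. carrier A)"
  by (simp add: eilenberg_mac_lane_def carrier_cosk level_em_trunc)

lemma E_mem_PiE:
  "y \<in> carrier (level E k) \<Longrightarrow> \<theta> \<in> monotone_maps (Suc N) k \<Longrightarrow>
   y \<theta> \<in> (\<Pi>\<^sub>E j\<in>{..<em_rank N (length \<theta> - 1)}. carrier A)"
  by (rule PiE_mem[OF E_PiE])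

lemma E_face:
  "y \<in> carrier (level E k) \<Longrightarrow> \<theta> \<in> monotone_maps (Suc N) k \<Longrightarrow> i < length \<theta> \<Longrightarrow> 2 \<le> length \<theta> \<Longrightarrow>
   face (em_trunc A N) (length \<theta> - 1) i (y \<theta>) = y (delete_at i \<theta>)"
  by (simp add: eilenberg_mac_lane_def carrier_cosk)

lemma E_degen:
  "y \<in> carrier (level E k) \<Longrightarrow> \<theta> \<in> monotone_maps (Suc N) k \<Longrightarrow> i < length \<theta> \<Longrightarrow> length \<theta> \<le> Suc N \<Longrightarrow>
   degen (em_trunc A N) (length \<theta> - 1) i (y \<theta>) = y (repeat_at i \<theta>)"
  by (simp add: eilenberg_mac_lane_def carrier_cosk)

text \<open>All other entries of the family are forced: on a list of length N + 1 with a repetition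
  the value is a degeneracy out of a trivial group, on longer lists it is fixed by its faces, and on
  shorter lists the group is trivial.\<close>

lemma E_eqI:
  assumes y: "y \<in> carrier (level E k)" "y' \<in> carrier (level E k)"
    and eq: "\<And>\<theta>. length \<theta> = Suc N \<Longrightarrow> set \<theta> \<subseteq> {..k} \<Longrightarrow> sorted \<theta> \<Longrightarrow> distinct \<theta> \<Longrightarrow> y \<theta> 0 = y' \<theta> 0"
  shows "y = y'"
proof -
  have N: "y \<theta> = y' \<theta>" if \<theta>: "\<theta> \<in> monotone_maps (Suc N) k" "length \<theta> = Suc N" for \<theta>
  proof (cases "distinct \<theta>")
    case True
    have "y \<theta> 0 = y' \<theta> 0" using \<theta> True by (intro eq) (auto simp: monotone_maps_def)
    then show ?thesis
      using \<theta>(2) by (intro PiE_ext[OF E_mem_PiE[OF y(1) \<theta>(1)] E_mem_PiE[OF y(2) \<theta>(1)]])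
        (simp add: em_rank_def)
  next
    case False
    have "sorted \<theta>" using \<theta> by (simp add: monotone_maps_def)
    then obtain a where a: "Suc a < length \<theta>" "\<theta> ! a = \<theta> ! Suc a"
      using False by (rule sorted_not_distinct)
    let ?\<psi> = "delete_at a \<theta>"
    have \<psi>: "?\<psi> \<in> monotone_maps (Suc N) k" "length ?\<psi> = N" "a < length ?\<psi>"
      using monotone_maps_delete_at[OF \<theta>(1), of a] a \<theta>(2) by (auto simp: length_delete_at)
    have "z \<theta> = (\<lambda>j\<in>{..<1}. \<one>\<^bsub>A\<^esub>)" if z: "z \<in> carrier (level E k)" for z
    proof -
      have "z \<theta> = degen (em_trunc A N) n a (z ?\<psi>)"
        using E_degen[OF z \<psi>(1,3)] \<psi>(2) by (simp add: repeat_at_delete_at[OF a])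
      also have "\<dots> = (\<lambda>j\<in>{..<1}. \<one>\<^bsub>A\<^esub>)"
        by (simp add: em_trunc_def em_rank_def)
      finally show ?thesis .
    qed
    from this[OF y(1)] this[OF y(2)] show ?thesis by simp
  qed
  show ?thesis
  proof (rule PiE_ext[OF E_PiE[OF y(1)] E_PiE[OF y(2)]])
    fix \<theta> assume \<theta>: "\<theta> \<in> monotone_maps (Suc N) k"
    from \<theta> show "y \<theta> = y' \<theta>"
    proof (cases rule: monotone_maps_length_cases)
      case 1
      then have "length \<theta> - 1 < N" by simp
      then show ?thesis
        using E_mem_PiE[OF y(1) \<theta>] E_mem_PiE[OF y(2) \<theta>] by (simp add: em_rank_def)
    next
      case 2 then show ?thesis using N \<theta> by blast
    next
      case 3
      have f: "face (em_trunc A N) (Suc N) i (y \<theta>) = face (em_trunc A N) (Suc N) i (y' \<theta>)" if i: "i \<le> N" for i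
      proof -
        have "delete_at i \<theta> \<in> monotone_maps (Suc N) k" "length (delete_at i \<theta>) = Suc N"
          using monotone_maps_delete_at[OF \<theta>, of i] 3 i by (auto simp: length_delete_at)
        then have "y (delete_at i \<theta>) = y' (delete_at i \<theta>)" by (rule N)
        then show ?thesis
          using E_face[OF y(1) \<theta>, of i] E_face[OF y(2) \<theta>, of i] 3 i by simp
      qed
      have m: "y \<theta> \<in> (\<Pi>\<^sub>E j\<in>{..<Suc N}. carrier A)" "y' \<theta> \<in> (\<Pi>\<^sub>E j\<in>{..<Suc N}. carrier A)"
        using E_mem_PiE[OF y(1) \<theta>] E_mem_PiE[OF y(2) \<theta>] unfolding 3 by (simp_all add: em_rank_def)
      show ?thesis by (rule em_trunc_top_eqI[OF m f])
    qed
  qed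
qed

text \<open>Uniqueness of horn fillers above degree N. A list that misses some j up to k factors
  through a prescribed face; only the face opposite the last vertex of an (N + 1)-simplex escapes
  this.\<close>

lemma E_eq_of_faces:
  assumes y: "y \<in> carrier (level E (Suc k))" "y' \<in> carrier (level E (Suc k))" and k: "N \<le> k"
    and eq: "\<And>i. i \<le> k \<Longrightarrow> face E (Suc k) i y = face E (Suc k) i y'"
  shows "y = y'"
proof (rule E_eqI[OF y])
  fix \<theta> assume \<theta>: "length \<theta> = Suc N" "set \<theta> \<subseteq> {..Suc k}" "sorted \<theta>" "distinct \<theta>"
  have delta_eq: "y (map (delta i) \<rho>) = y' (map (delta i) \<rho>)" if "i \<le> k" "\<rho> \<in> monotone_maps (Suc N) k" for i \<rho>
    using fun_cong[OF eq[OF that(1)], of \<rho>] that(2) by (simp add: eilenberg_mac_lane_def face_cosk)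
  show "y \<theta> 0 = y' \<theta> 0"
  proof (cases "{..k} \<subseteq> set \<theta>")
    case False
    then obtain j where j: "j \<le> k" "j \<notin> set \<theta>" by auto
    let ?\<rho> = "map (sigma j) \<theta>"
    have eq': "\<theta> = map (delta j) ?\<rho>"
      using j by (auto simp: map_idI sigma_def delta_def intro!: map_idI[symmetric])
    have "\<theta> \<in> monotone_maps (Suc N) (Suc k)" using \<theta> by (auto simp: monotone_maps_def)
    then have "?\<rho> \<in> monotone_maps (Suc N) k" using j by (intro monotone_maps_sigma)
    then show ?thesis using delta_eq[OF j(1), of ?\<rho>] eq' by simp
  next
    case True
    \<comment> \<open>Containing all of 0, ..., k leaves room only for k = N and the identity list;
      its value is the last face of the entry at \<open>?\<tau>\<close>, which the other faces
      determine.\<close>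
    have "Suc k \<le> Suc N"
      using card_mono[OF _ True] distinct_card[OF \<theta>(4)] \<theta>(1) by simp
    then have kN: "k = N" using k by simp
    have "set \<theta> = {..N}"
      using True distinct_card[OF \<theta>(4)] \<theta>(1) kN by (intro card_subset_eq[symmetric]) auto
    moreover have "sorted_wrt (<) \<theta>" using \<theta> by (simp add: strict_sorted_iff)
    ultimately have id: "\<theta> = [0..<Suc N]"
      by (intro strict_sorted_equal) (auto simp: atMost_atLeast0 atLeastLessThanSuc_atLeastAtMost simp del: upt_Suc)
    let ?\<tau> = "[0..<Suc (Suc N)]"
    have \<tau>: "?\<tau> \<in> monotone_maps (Suc N) (Suc k)" "length ?\<tau> = Suc (Suc N)"
      using kN by (auto simp: monotone_maps_def simp del: upt_Suc)
    have face: "face (em_trunc A N) (Suc N) i (z ?\<tau>) = z (map (delta i) [0..<Suc N])"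
      if "z \<in> carrier (level E (Suc k))" "i \<le> Suc N" for z i
    proof -
      have "face (em_trunc A N) (length ?\<tau> - 1) i (z ?\<tau>) = z (delete_at i ?\<tau>)"
        using E_face[OF that(1) \<tau>(1), of i] that(2) \<tau>(2) by (simp del: upt_Suc)
      then show ?thesis using that(2) delete_at_upt[of i "Suc N"] by (simp del: upt_Suc)
    qed
    have "[0..<Suc N] \<in> monotone_maps (Suc N) k"
      using kN by (auto simp: monotone_maps_def simp del: upt_Suc)
    then have f: "face (em_trunc A N) (Suc N) i (y ?\<tau>) = face (em_trunc A N) (Suc N) i (y' ?\<tau>)" if "i \<le> N" for i
      using that face[OF y(1), of i] face[OF y(2), of i] delta_eq[of i "[0..<Suc N]"] kN
      by (simp del: upt_Suc)
    have m: "y ?\<tau> \<in> (\<Pi>\<^sub>E j\<in>{..<Suc N}. carrier A)" "y' ?\<tau> \<in> (\<Pi>\<^sub>E j\<in>{..<Suc N}. carrier A)"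
      using E_mem_PiE[OF y(1) \<tau>(1)] E_mem_PiE[OF y(2) \<tau>(1)] unfolding \<tau>(2)
      by (simp_all add: em_rank_def)
    have "y ?\<tau> = y' ?\<tau>" by (rule em_trunc_top_eqI[OF m f])
    moreover have "map (delta (Suc N)) [0..<Suc N] = \<theta>"
      unfolding id by (intro map_idI) (auto simp: delta_def)
    ultimately have "y \<theta> = y' \<theta>" using face[OF y(1), of "Suc N"] face[OF y(2), of "Suc N"] by simp
    then show ?thesis by simp
  qed
qed

text \<open>Lifts of the faces 0, ..., k of \<open>y\<close> are filled to an element of
  \<open>Y\<close>, whose image agrees with \<open>y\<close> on these faces and so equals
  \<open>y\<close> by uniqueness of fillers.\<close>

lemma em_map_surj: "y \<in> carrier (level E k) \<Longrightarrow> \<exists>x\<in>carrier (level Y k). em_map k x = y"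
proof (induction k arbitrary: y)
  have small: "\<exists>x\<in>carrier (level Y k). em_map k x = y" if y: "y \<in> carrier (level E k)" and k: "k \<le> N" for y k
  proof -
    \<comment> \<open>In degree N the preimage is the single coordinate of \<open>y\<close> at the
      identity; below N the level is trivial.\<close>
    define x where "x = (if k = N then y [0..<Suc N] 0 else \<one>\<^bsub>level Y k\<^esub>)"
    have x: "x \<in> carrier (level Y k)"
    proof (cases "k = N")
      case True
      then have "[0..<Suc N] \<in> monotone_maps (Suc N) k" by (auto simp: monotone_maps_def simp del: upt_Suc)
      from PiE_mem[OF E_mem_PiE[OF y this], of 0] show ?thesis
        using True by (simp add: x_def em_rank_def del: upt_Suc)
    qed (simp add: x_def)
    have "em_map k x = y"
    proof (rule E_eqI[OF em_map_closed[OF x] y])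
      fix \<theta> assume \<theta>: "length \<theta> = Suc N" "set \<theta> \<subseteq> {..k}" "sorted \<theta>" "distinct \<theta>"
      from \<theta>(3,4,1,2) show "em_map k x \<theta> 0 = y \<theta> 0"
      proof (cases rule: monotone_map_cases)
        case id
        then have "\<theta> \<in> monotone_maps (Suc N) k" by (auto simp: monotone_maps_def simp del: upt_Suc)
        then show ?thesis using id cochain_id[of x]
          by (simp add: em_map_def em_vec_def em_rank_def x_def del: upt_Suc)
      next
        case delta then show ?thesis using k by simp
      qed
    qed
    then show ?thesis using x by blast
  qed
  {
    case 0
    then show ?case using small by blast
  next
    case (Suc k)
    show ?case
    proof (cases "Suc k \<le> N")
      case True then show ?thesis using small Suc.prems by blast
    next
      case False
      have fE: "face E (Suc k) i y \<in> carrier (level E k)" if "i \<le> Suc k" for i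
        using Suc.prems that face_cosk_closed unfolding eilenberg_mac_lane_def by blast
      have "\<forall>i\<in>{..k}. \<exists>x. x \<in> carrier (level Y k) \<and> em_map k x = face E (Suc k) i y"
      proof
        fix i assume "i \<in> {..k}"
        then show "\<exists>x. x \<in> carrier (level Y k) \<and> em_map k x = face E (Suc k) i y"
          using Suc.IH[OF fE[of i]] by auto
      qed
      then obtain x where "\<forall>i\<in>{..k}. x i \<in> carrier (level Y k) \<and> em_map k (x i) = face E (Suc k) i y"
        by (rule bchoice[THEN exE])
      then have x: "x i \<in> carrier (level Y k)" "em_map k (x i) = face E (Suc k) i y" if "i \<le> k" for i
        using that by auto
      have "\<exists>w\<in>carrier (level Y (Suc k)). \<forall>i<Suc k. face Y (Suc k) i w = x i"
      proof (rule horn_filler_upto[where T = "carrier (level Y k)"])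
        fix i j assume ij: "i < j" "j \<le> k" "0 < k"
        then obtain k' where k': "k = Suc k'" by (cases k) auto
        \<comment> \<open>The lifts are chosen independently, but injectivity of
          \<open>em_map\<close> transfers the compatibility of the faces of \<open>y\<close> to
          them.\<close>
        show "face Y k i (x j) = face Y k (j - 1) (x i)"
        proof (rule em_map_inj[of _ k'])
          have "em_map k' (face Y k i (x j)) = face E k i (face E (Suc k) j y)"
            using ij em_map_face[of i k' "x j"] x[of j] unfolding k' by simp
          also have "\<dots> = face E k (j - 1) (face E (Suc k) i y)"
            using ij face_face_cosk[of i j k'] unfolding k' eilenberg_mac_lane_def by simp
          also have "\<dots> = em_map k' (face Y k (j - 1) (x i))"
            using ij em_map_face[of "j - 1" k' "x i"] x[of i] unfolding k' by simp
          finally show "em_map k' (face Y k i (x j)) = em_map k' (face Y k (j - 1) (x i))" .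
        qed (use ij x k' in auto)
      qed (auto simp: lev.subgroup_self x(1))
      then obtain w where w: "w \<in> carrier (level Y (Suc k))" "\<And>i. i \<le> k \<Longrightarrow> face Y (Suc k) i w = x i"
        by auto
      have "em_map (Suc k) w = y"
      proof (rule E_eq_of_faces[OF em_map_closed[OF w(1)] Suc.prems])
        show "N \<le> k" using False by simp
        fix i assume "i \<le> k"
        then show "face E (Suc k) i (em_map (Suc k) w) = face E (Suc k) i y"
          using em_map_face[of i k w] w x(2)[of i] by simp
      qed
      then show ?thesis using w by blast
    qed
  }
qed

lemma simplicial_iso_eilenberg_mac_lane: "simplicial_iso Y E"
  unfolding simplicial_iso_def
proof (intro exI conjI allI)
  have hom: "em_map k \<in> hom (level Y k) (level E k)" for k
    by (simp add: hom_def em_map_closed em_map_mult)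
  then show "simplicial_hom Y E em_map"
    by (simp add: simplicial_hom_def em_map_face em_map_degen)
  fix k
  have "bij_betw (em_map k) (carrier (level Y k)) (carrier (level E k))"
    using em_map_closed em_map_inj em_map_surj by (force simp: bij_betw_def inj_on_def)
  then show "em_map k \<in> iso (level Y k) (level E k)"
    using hom by (simp add: iso_def)
qed

end

section \<open>The four quotients\<close>

context simplicial_group
begin

text \<open>Rewritten one degree lower, the left side is the extension of the trivial subgroup of
  degree n, so monotonicity applies.\<close>

lemma cosk_ext_cycles_subset:
  assumes "S \<lhd> level X n"
  shows "cosk_ext X (Suc n) (moore_cycles X (Suc n)) k \<subseteq> cosk_ext X n S k"
  unfolding cosk_ext_trivial[symmetric]
  by (rule cosk_ext_mono) (use normal_imp_subgroup[OF assms, THEN subgroup.one_closed] in simp)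

lemma moore_subset_cosk_ext_cycles:
  "m \<le> k \<Longrightarrow> moore X (Suc k) \<subseteq> cosk_ext X m (moore_cycles X m) (Suc k)"
  using moore_subset_cot_kernel cosk_ext_mono[OF moore_boundaries_subset] by blast

lemma simplicial_subquotient_cosk_ext:
  assumes "S \<lhd> level X m" "S \<subseteq> moore_cycles X m" "T \<lhd> level X l" "T \<subseteq> moore_cycles X l"
    and "\<And>k. cosk_ext X m S k \<subseteq> cosk_ext X l T k"
  shows "simplicial_subquotient X (cosk_ext X m S) (cosk_ext X l T)"
  using assms
  by (intro simplicial_subquotient.intro simplicial_subquotient_axioms.intro
      normal_simplicial_subgroup_cosk_ext)

text \<open>Trivial \<open>S\<close> gives the quotient by \<mu> of the coskeleton in degree n + 2,
  and \<open>S\<close> equal to the boundaries the quotient by \<mu> of the reflection in degree n +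
  1.\<close>

lemma K_simplicial_group_cot_kernel:
  assumes S: "S \<lhd> level X (Suc n)" "S \<subseteq> moore_boundaries X (Suc n)"
  shows "K_simplicial_group (homotopy_group (Suc n) X) (Suc n)
    (subquotient X (cot_kernel n) (cosk_ext X (Suc n) S))"
proof -
  have SZ: "S \<subseteq> moore_cycles X (Suc n)" using S(2) moore_boundaries_subset by blast
  have "cosk_ext X (Suc n) S k \<subseteq> cot_kernel n k" for k
    using cosk_ext_mono[OF SZ] cosk_ext_cycles_subset[OF normal_moore_boundaries] by blast
  then interpret Q: simplicial_subquotient X "cosk_ext X (Suc n) S" "cot_kernel n"
    by (rule simplicial_subquotient_cosk_ext[OF S(1) SZ normal_moore_boundaries moore_boundaries_subset])
  show ?thesis
  proof (rule Q.K_simplicial_group_Q)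
    show "moore_cycles X (Suc n) \<subseteq> cot_kernel n (Suc n)"
      by (rule moore_cycles_subset_cosk_ext[OF normal_moore_boundaries order_refl])
    show "moore X (Suc (Suc n)) \<subseteq> cot_kernel n (Suc (Suc n))"
      by (rule moore_subset_cot_kernel) simp
    \<comment> \<open>In degree n the group consists of boundaries, and their Moore preimages all
      lie in \<open>cot_kernel n\<close>, so no homology remains there.\<close>
    show "cot_kernel n n \<subseteq> face X (Suc n) (Suc n) ` (moore X (Suc n) \<inter> cot_kernel n (Suc n))"
      using moore_subset_cot_kernel[of n n] by (auto simp: moore_boundaries_def)
    show "x \<in> cosk_ext X (Suc n) S (Suc k)"
      if "n < k" "x \<in> carrier (level X (Suc k))"
        "\<And>i. i \<le> Suc k \<Longrightarrow> face X (Suc k) i x \<in> cosk_ext X (Suc n) S k" for k x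
      unfolding cosk_ext_Suc[OF Suc_leI[OF that(1)]] using that by blast
  qed (use S in \<open>simp_all add: cosk_ext_less\<close>)
qed

lemma simplicial_subquotient_cycles:
  assumes "S \<lhd> level X m" "S \<subseteq> moore_cycles X m"
  shows "simplicial_subquotient X (cosk_ext X m S) (cosk_ext X m (moore_cycles X m))"
  by (rule simplicial_subquotient_cosk_ext[OF assms normal_moore_cycles order_refl
        cosk_ext_mono[OF assms(2)]])

lemma K_simplicial_group_cycles:
  assumes S: "S \<lhd> level X (Suc n)" "S \<subseteq> moore_boundaries X (Suc n)"
  shows "K_simplicial_group (homotopy_group (Suc n) X) (Suc n)
    (subquotient X (cosk_ext X (Suc n) (moore_cycles X (Suc n))) (cosk_ext X (Suc n) S))"
proof -
  have SZ: "S \<subseteq> moore_cycles X (Suc n)" using S(2) moore_boundaries_subset by blast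
  let ?K = "cosk_ext X (Suc n) (moore_cycles X (Suc n))"
  interpret Q: simplicial_subquotient X "cosk_ext X (Suc n) S" ?K
    by (rule simplicial_subquotient_cycles[OF S(1) SZ])
  show ?thesis
  proof (rule Q.K_simplicial_group_Q)
    show "moore X (Suc (Suc n)) \<subseteq> ?K (Suc (Suc n))"
      by (rule moore_subset_cosk_ext_cycles) simp
    have "\<one>\<^bsub>level X (Suc n)\<^esub> \<in> moore X (Suc n) \<inter> ?K (Suc n)"
      using normal_imp_subgroup[OF normal_moore, THEN subgroup.one_closed]
        normal_imp_subgroup[OF normal_moore_cycles, THEN subgroup.one_closed] by simp
    then have "face X (Suc n) (Suc n) \<one>\<^bsub>level X (Suc n)\<^esub> \<in> face X (Suc n) (Suc n) ` (moore X (Suc n) \<inter> ?K (Suc n))"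
      by (rule imageI)
    then show "?K n \<subseteq> face X (Suc n) (Suc n) ` (moore X (Suc n) \<inter> ?K (Suc n))"
      by (simp add: cosk_ext_less)
    show "x \<in> cosk_ext X (Suc n) S (Suc k)"
      if "n < k" "x \<in> carrier (level X (Suc k))"
        "\<And>i. i \<le> Suc k \<Longrightarrow> face X (Suc k) i x \<in> cosk_ext X (Suc n) S k" for k x
      unfolding cosk_ext_Suc[OF Suc_leI[OF that(1)]] using that by blast
  qed (use S in \<open>simp_all add: cosk_ext_less\<close>)
qed

text \<open>Here the quotient is trivial up to degree n and its Moore complex vanishes above n + 1,
  since \<open>cot_kernel (Suc n)\<close> absorbs the Moore elements of \<open>X\<close>
  there.\<close>

lemma simplicial_iso_cycles_boundaries:
  "simplicial_iso
     (subquotient X (cosk_ext X (Suc n) (moore_cycles X (Suc n))) (cot_kernel (Suc n)))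
     (eilenberg_mac_lane (homotopy_group (Suc n) X) (Suc n))"
proof -
  let ?K = "cosk_ext X (Suc n) (moore_cycles X (Suc n))"
  interpret Q: simplicial_subquotient X "cot_kernel (Suc n)" ?K
    by (rule simplicial_subquotient_cycles[OF normal_moore_boundaries moore_boundaries_subset])
  \<comment> \<open>Level n + 1 is cycles modulo boundaries on the nose, so the coefficient group
    needs no transport along an isomorphism.\<close>
  have level: "level Q.Q (Suc n) = homotopy_group (Suc n) X"
    by (simp add: subquotient_def homotopy_group_def)
  have "carrier (level Q.Q k) = {\<one>\<^bsub>level Q.Q k\<^esub>}" if "k \<le> n" for k
  proof -
    have "\<one>\<^bsub>level X k\<^esub> \<in> ?K k" "\<one>\<^bsub>level X k\<^esub> \<in> cot_kernel (Suc n) k"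
      by (rule Q.K.sub.one_closed Q.H.sub.one_closed)+
    then have "Q.cl k \<one>\<^bsub>level X k\<^esub> = \<one>\<^bsub>level Q.Q k\<^esub>" using Q.cl_eq_one_iff by blast
    then show ?thesis using that by (simp add: Q.carrier_Q cosk_ext_less)
  qed
  moreover have "moore Q.Q k \<subseteq> {\<one>\<^bsub>level Q.Q k\<^esub>}" if k: "Suc n < k" for k
  proof -
    obtain j where j: "k = Suc j" "Suc n \<le> j" using k by (cases k) auto
    show ?thesis
    proof
      fix c assume "c \<in> moore Q.Q k"
      then obtain x where "x \<in> moore X k" "x \<in> ?K k" "c = Q.cl k x"
        unfolding Q.moore_Q by blast
      then show "c \<in> {\<one>\<^bsub>level Q.Q k\<^esub>}"
        using moore_subset_cot_kernel[OF j(2)] j Q.cl_eq_one_iff[of x k] by auto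
    qed
  qed
  ultimately interpret C: concentrated_simplicial_group Q.Q n
    by (intro concentrated_simplicial_group.intro concentrated_simplicial_group_axioms.intro
        Q.simplicial_group_Q) (simp_all add: level homotopy_group_comm)
  show ?thesis using C.simplicial_iso_eilenberg_mac_lane by (simp add: level)
qed

end

theorem corollary7p6:
  fixes X :: "'a sgrp" and n :: nat
  assumes "simplicial_group X"
  shows "K_simplicial_group (homotopy_group (n + 1) X) (n + 1)
           (subquotient X (mu_Cot n X) (mu_cosk (n + 2) X)) \<and>
         K_simplicial_group (homotopy_group (n + 1) X) (n + 1)
           (subquotient X (mu_Cot n X) (mu_Cot (n + 1) X)) \<and>
         K_simplicial_group (homotopy_group (n + 1) X) (n + 1)
           (subquotient X (mu_cosk (n + 1) X) (mu_cosk (n + 2) X)) \<and>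
         K_simplicial_group (homotopy_group (n + 1) X) (n + 1)
           (subquotient X (mu_cosk (n + 1) X) (mu_Cot (n + 1) X)) \<and>
         simplicial_iso (subquotient X (mu_cosk (n + 1) X) (mu_Cot (n + 1) X))
           (eilenberg_mac_lane (homotopy_group (n + 1) X) (n + 1))"
proof -
  interpret simplicial_group X by (rule assms)
  \<comment> \<open>Both kernels are expressed by a subgroup of degree \<open>Suc n\<close>, the
    cycles and the trivial group, one of them after the shift by
    \<open>cosk_ext_trivial\<close>.\<close>
  have mu: "mu_cosk (n + 1) X = cosk_ext X (Suc n) (moore_cycles X (Suc n))"
    "mu_cosk (n + 2) X = cosk_ext X (Suc n) {\<one>\<^bsub>level X (Suc n)\<^esub>}"
    using mu_cosk_eq[of n] mu_cosk_eq[of "Suc n"] cosk_ext_trivial[of n] by (simp_all add: numeral_2_eq_2)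
  have one: "{\<one>\<^bsub>level X (Suc n)\<^esub>} \<lhd> level X (Suc n)"
    "{\<one>\<^bsub>level X (Suc n)\<^esub>} \<subseteq> moore_boundaries X (Suc n)"
    using lev.one_is_normal normal_imp_subgroup[OF normal_moore_boundaries, THEN subgroup.one_closed]
    by auto
  show ?thesis
    unfolding mu mu_Cot_eq unfolding Suc_eq_plus1[symmetric]
    by (intro conjI K_simplicial_group_cot_kernel K_simplicial_group_cycles one
        normal_moore_boundaries order_refl simplicial_iso_cycles_boundaries)
qed

end
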